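(* Let $P_n$ be the path on $n\ge 2$ vertices. Then there exists a non-zero real number $q$ such that $P_n$ admits $q$-Laplacian vertex pretty good state transfer between its end vertices.
   Context: $P_n$ is the (unweighted, no potential) path on vertices $1,\dots,n$ with $j,k$ adjacent iff $|j-k|=1$, with adjacency matrix $A$ and diagonal degree matrix $\Delta$. For a non-zero real $q$, its $q$-Laplacian matrix is $\mathscr{L}=(1-q^2)I+q^2\Delta-qA$. Vertex pretty good state transfer between distinct vertices $u,v$ with respect to $\mathscr{L}$ means there are a real sequence $(\tau_k)$ and $\gamma\in\mathbb{C}$ with $|\gamma|=1$ such that $\lim_{k\to\infty}\exp(i\tau_k\mathscr{L})\mathbf{e}_u=\gamma\mathbf{e}_v$, where $\mathbf{e}_u$ is the characteristic vector of $u$. *)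

theory Defs
  imports Complex_Main "Jordan_Normal_Form.Matrix"
begin

text \<open>
  A graph on \<open>n\<close> vertices is given by \<open>n\<close> and an adjacency relation on \<open>{..<n}\<close>. Following the
  0-based indexing of matrices, the vertices of the path \<open>P\<^sub>n\<close> are labelled \<open>0, \<dots>, n - 1\<close> instead
  of \<open>1, \<dots>, n\<close>; its end vertices are thus \<open>0\<close> and \<open>n - 1\<close>.
\<close>

definition path_graph :: "nat \<Rightarrow> nat \<Rightarrow> nat \<Rightarrow> bool" where
  "path_graph n j k \<longleftrightarrow> j < n \<and> k < n \<and> \<bar>int j - int k\<bar> = 1"

definition adjacency_matrix :: "nat \<Rightarrow> (nat \<Rightarrow> nat \<Rightarrow> bool) \<Rightarrow> real mat" where
  "adjacency_matrix n E = mat n n (\<lambda>(j, k). if E j k then 1 else 0)"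

definition vertex_degree :: "nat \<Rightarrow> (nat \<Rightarrow> nat \<Rightarrow> bool) \<Rightarrow> nat \<Rightarrow> nat" where
  "vertex_degree n E j = card {k. k < n \<and> E j k}"

definition degree_matrix :: "nat \<Rightarrow> (nat \<Rightarrow> nat \<Rightarrow> bool) \<Rightarrow> real mat" where
  "degree_matrix n E = mat n n (\<lambda>(j, k). if j = k then real (vertex_degree n E j) else 0)"

definition q_laplacian :: "real \<Rightarrow> nat \<Rightarrow> (nat \<Rightarrow> nat \<Rightarrow> bool) \<Rightarrow> real mat" where
  "q_laplacian q n E =
     (1 - q\<^sup>2) \<cdot>\<^sub>m 1\<^sub>m n + q\<^sup>2 \<cdot>\<^sub>m degree_matrix n E - q \<cdot>\<^sub>m adjacency_matrix n E"

text \<open>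
  The matrix type carries no topology, so the exponential series is summed entrywise. For square
  matrices every entry converges (\<open>summable_mat_exp\<close> below), so \<open>suminf\<close> is meaningful.
\<close>

definition mat_exp :: "complex mat \<Rightarrow> complex mat" where
  "mat_exp A = mat (dim_row A) (dim_row A) (\<lambda>(i, j). \<Sum>k. (A ^\<^sub>m k) $$ (i, j) / fact k)"

lemma summable_mat_exp:
  fixes A :: "complex mat"
  assumes A: "A \<in> carrier_mat n n" and ij: "i < n" "j < n"
  shows "summable (\<lambda>k. (A ^\<^sub>m k) $$ (i, j) / fact k)"
proof -
  define M where "M = (\<Sum>a<n. \<Sum>b<n. cmod (A $$ (a, b)))"
  have M: "cmod (A $$ (a, b)) \<le> M" if "a < n" "b < n" for a b
  proof -
    have "cmod (A $$ (a, b)) \<le> (\<Sum>b<n. cmod (A $$ (a, b)))"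
      using that by (intro member_le_sum) auto
    also have "\<dots> \<le> M"
      unfolding M_def using that
      by (intro member_le_sum[where f = "\<lambda>a. \<Sum>b<n. cmod (A $$ (a, b))"]) (auto intro: sum_nonneg)
    finally show ?thesis .
  qed
  have M0: "0 \<le> M" unfolding M_def by (intro sum_nonneg) auto
  have bound: "cmod ((A ^\<^sub>m k) $$ (a, b)) \<le> (real n * M) ^ k" if "a < n" "b < n" for a b k
    using that
  proof (induction k arbitrary: a b)
    case 0
    then show ?case using A by auto
  next
    case (Suc k)
    have "(A ^\<^sub>m Suc k) $$ (a, b) = (\<Sum>c<n. (A ^\<^sub>m k) $$ (a, c) * A $$ (c, b))"
      using A Suc.prems pow_carrier_mat[OF A, of k]
      by (simp add: scalar_prod_def atLeast0LessThan)
    also have "cmod \<dots> \<le> (\<Sum>c<n. (real n * M) ^ k * M)"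
      using Suc M M0 by (intro sum_norm_le) (auto simp: norm_mult intro!: mult_mono)
    also have "\<dots> = (real n * M) ^ Suc k" by simp
    finally show ?case .
  qed
  show ?thesis
  proof (rule summable_comparison_test')
    show "summable (\<lambda>k. inverse (fact k) * (real n * M) ^ k)" by (rule summable_exp)
    show "norm ((A ^\<^sub>m k) $$ (i, j) / fact k) \<le> inverse (fact k) * (real n * M) ^ k"
      if "k \<ge> 0" for k
      using bound[OF ij, of k] by (simp add: norm_divide field_simps)
  qed
qed

text \<open>Convergence in \<open>\<complex>\<^sup>n\<close>, written out coordinatewise.\<close>

definition vec_tendsto :: "(nat \<Rightarrow> complex vec) \<Rightarrow> complex vec \<Rightarrow> bool" where
  "vec_tendsto X v \<longleftrightarrow>
     (\<forall>k. dim_vec (X k) = dim_vec v) \<and> (\<forall>i < dim_vec v. (\<lambda>k. X k $ i) \<longlonglongrightarrow> v $ i)"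

definition pretty_good_state_transfer :: "real mat \<Rightarrow> nat \<Rightarrow> nat \<Rightarrow> bool" where
  "pretty_good_state_transfer L u v \<longleftrightarrow>
     u < dim_row L \<and> v < dim_row L \<and> u \<noteq> v \<and>
     (\<exists>(\<tau> :: nat \<Rightarrow> real) (\<gamma> :: complex). cmod \<gamma> = 1 \<and>
        vec_tendsto
          (\<lambda>k. mat_exp ((\<i> * complex_of_real (\<tau> k)) \<cdot>\<^sub>m map_mat complex_of_real L)
                 *\<^sub>v unit_vec (dim_row L) u)
          (\<gamma> \<cdot>\<^sub>v unit_vec (dim_row L) v))"

end

theory Submission
  imports Defs
    "Jordan_Normal_Form.Schur_Decomposition"
    "HOL-Computational_Algebra.Fundamental_Theorem_Algebra"
    "HOL-Analysis.Continuum_Not_Denumerable"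
    "HOL-Analysis.Kronecker_Approximation_Theorem"
begin

text \<open>
  Write \<open>L = (1 + q\<^sup>2) I - q H\<close>, where \<open>H\<close> is the adjacency matrix of the path with \<open>q\<close> as
  diagonal entry at its two ends. Reflection of the path commutes with \<open>H\<close>, and
  \<open>e\<^sub>0 = (e\<^sub>0 + e\<^bsub>n-1\<^esub>) / 2 + (e\<^sub>0 - e\<^bsub>n-1\<^esub>) / 2\<close>. So state transfer from \<open>0\<close> to \<open>n - 1\<close> happens at a time
  at which all eigenvalues occurring in the symmetric part have one common phase \<open>\<gamma>\<close>, and all those in
  the antisymmetric part the phase \<open>- \<gamma>\<close>. By Kronecker's theorem such times exist approximately
  as soon as the wanted phases respect every integer linear relation between the
  eigenvalues (\<open>Kronecker_with_relations\<close>). It remains to control these relations.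

  The symmetric and the antisymmetric eigenvalues of \<open>H\<close> are roots of two polynomials of the form
  \<open>U - q V\<close>, with \<open>U\<close> and \<open>V\<close> integral and comaximal (\<open>annihilates_mirror_vector\<close>,
  \<open>comaximal_half_path_poly\<close>). All but
  countably many \<open>q\<close> make all roots of both polynomials transcendental, and then, because \<open>q\<close>
  enters linearly, both polynomials are irreducible over \<open>K = \<rat>(q)\<close> (\<open>irreducible_over_pencil\<close>).

  Galois theory would now average a relation over all conjugates. The same conclusion comes from traces:
  all the roots act by multiplication on one finite-dimensional \<open>K\<close>-subspace of \<open>\<complex>\<close>, and the normalised
  trace of the action of a root of an irreducible polynomial is the mean of all roots of that polynomial.
  Hence a \<open>K\<close>-linear relation between the eigenvalues persists when every eigenvalue is replaced by
  the mean over its conjugates (\<open>linear_relation_root_means\<close>). Wanted phases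
  proportional to \<open>1 + q\<^sup>2 - q \<mu>\<close>, with \<open>\<mu>\<close> this mean, are therefore admissible. The means of the symmetric and of the antisymmetric roots differ: for \<open>n = 2 m\<close>
  they are \<open>(q + 1) / m\<close> and \<open>(q - 1) / m\<close>, for \<open>n = 2 m + 1\<close> they are \<open>q / (m + 1)\<close> and \<open>q / m\<close>.
  So the factor of proportionality can be chosen to make the two phases opposite.
\<close>

section \<open>Polynomials over a subring or subfield of the complex numbers\<close>

definition polys_over :: "complex set \<Rightarrow> complex poly set" where
  "polys_over R = {p. \<forall>i. coeff p i \<in> R}"

locale complex_subring =
  fixes R :: "complex set"
  assumes one_closed: "1 \<in> R"
    and diff_closed: "a \<in> R \<Longrightarrow> b \<in> R \<Longrightarrow> a - b \<in> R"
    and mult_closed: "a \<in> R \<Longrightarrow> b \<in> R \<Longrightarrow> a * b \<in> R"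
begin

lemma zero_closed: "0 \<in> R"
  using diff_closed[OF one_closed one_closed] by simp

lemma uminus_closed: "a \<in> R \<Longrightarrow> - a \<in> R"
  using diff_closed[OF zero_closed] by fastforce

lemma add_closed: "a \<in> R \<Longrightarrow> b \<in> R \<Longrightarrow> a + b \<in> R"
  using diff_closed[OF _ uminus_closed, of a b] by simp

lemma sum_closed: "(\<And>i. i \<in> I \<Longrightarrow> f i \<in> R) \<Longrightarrow> sum f I \<in> R"
  by (induction I rule: infinite_finite_induct) (auto intro: zero_closed add_closed)

lemma of_int_closed: "of_int k \<in> R"
proof (induction k rule: int_induct[where k = 0])
  case base
  show ?case by (simp add: zero_closed)
next
  case (step1 i)
  then show ?case by (simp add: add_closed one_closed)
next
  case (step2 i)
  then show ?case by (simp add: diff_closed one_closed)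
qed

lemma const_polys_over: "a \<in> R \<Longrightarrow> [:a:] \<in> polys_over R"
  by (auto simp: polys_over_def coeff_pCons zero_closed split: nat.splits)

lemma pCons_polys_over: "a \<in> R \<Longrightarrow> p \<in> polys_over R \<Longrightarrow> pCons a p \<in> polys_over R"
  by (auto simp: polys_over_def coeff_pCons split: nat.splits)

lemma zero_polys_over: "0 \<in> polys_over R"
  by (simp add: polys_over_def zero_closed)

lemma one_polys_over: "1 \<in> polys_over R"
  using const_polys_over[OF one_closed] by (simp add: one_pCons)

lemma monom_polys_over: "a \<in> R \<Longrightarrow> monom a k \<in> polys_over R"
  by (auto simp: polys_over_def zero_closed)

lemma add_polys_over: "p \<in> polys_over R \<Longrightarrow> q \<in> polys_over R \<Longrightarrow> p + q \<in> polys_over R"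
  by (auto simp: polys_over_def add_closed)

lemma diff_polys_over: "p \<in> polys_over R \<Longrightarrow> q \<in> polys_over R \<Longrightarrow> p - q \<in> polys_over R"
  by (auto simp: polys_over_def diff_closed)

lemma smult_polys_over: "a \<in> R \<Longrightarrow> p \<in> polys_over R \<Longrightarrow> smult a p \<in> polys_over R"
  by (auto simp: polys_over_def mult_closed)

lemma mult_polys_over: "p \<in> polys_over R \<Longrightarrow> q \<in> polys_over R \<Longrightarrow> p * q \<in> polys_over R"
  by (auto simp: polys_over_def coeff_mult intro!: sum_closed mult_closed)

lemma power_polys_over: "p \<in> polys_over R \<Longrightarrow> p ^ k \<in> polys_over R"
  by (induction k) (auto intro: one_polys_over mult_polys_over)

lemma sum_polys_over: "(\<And>i. i \<in> I \<Longrightarrow> f i \<in> polys_over R) \<Longrightarrow> sum f I \<in> polys_over R"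
  by (induction I rule: infinite_finite_induct) (auto intro: zero_polys_over add_polys_over)

lemma prod_polys_over: "(\<And>i. i \<in> I \<Longrightarrow> f i \<in> polys_over R) \<Longrightarrow> prod f I \<in> polys_over R"
  by (induction I rule: infinite_finite_induct) (auto intro: one_polys_over mult_polys_over)

lemma pderiv_polys_over: "p \<in> polys_over R \<Longrightarrow> pderiv p \<in> polys_over R"
  using of_int_closed[of "int (Suc _)"]
  by (auto simp: polys_over_def coeff_pderiv intro!: mult_closed)

lemma char_poly_polys_over:
  assumes A: "A \<in> carrier_mat N N" and R: "\<And>i j. i < N \<Longrightarrow> j < N \<Longrightarrow> A $$ (i, j) \<in> R"
  shows "char_poly A \<in> polys_over R"
proof -
  have entry: "char_poly_matrix A $$ (i, j) \<in> polys_over R" if "i < N" "j < N" for i j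
    using that A R
    by (auto simp: char_poly_matrix_def intro!: pCons_polys_over zero_polys_over one_polys_over add_polys_over
        zero_closed one_closed uminus_closed diff_closed add_closed)
  have sgn: "signof \<pi> \<in> polys_over R" for \<pi> :: "nat \<Rightarrow> nat"
    using one_polys_over diff_polys_over[OF zero_polys_over one_polys_over]
    by (auto simp: sign_def)
  show ?thesis
    unfolding char_poly_def det_def'[OF char_poly_matrix_closed[OF A]]
    by (intro sum_polys_over mult_polys_over prod_polys_over sgn entry)
      (auto dest: permutes_in_image)
qed

lemma monic_division:
  assumes p: "p \<in> polys_over R" "lead_coeff p = 1" "degree p > 0" and f: "f \<in> polys_over R"
  shows "\<exists>g\<in>polys_over R. \<exists>h\<in>polys_over R. f = p * g + h \<and> degree h < degree p"
  using f
proof (induction "degree f" arbitrary: f rule: less_induct)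
  case less
  show ?case
  proof (cases "degree f < degree p")
    case True
    then show ?thesis using less.prems zero_polys_over by (intro bexI[of _ 0] bexI[of _ f]) auto
  next
    case False
    define t where "t = monom (lead_coeff f) (degree f - degree p)"
    have t: "t \<in> polys_over R"
      using less.prems by (auto simp: t_def polys_over_def zero_closed)
    have fnz: "f \<noteq> 0" using False p(3) by auto
    then have dt: "degree t = degree f - degree p"
      by (simp add: t_def degree_monom_eq)
    have tnz: "t \<noteq> 0" using fnz by (simp add: t_def monom_eq_0_iff)
    have pnz: "p \<noteq> 0" using p by auto
    have dpt: "degree (p * t) = degree f"
      using False dt tnz pnz by (simp add: degree_mult_eq)
    have "lead_coeff (p * t) = lead_coeff f"
      using p(2) by (simp add: lead_coeff_mult) (simp add: t_def degree_monom_eq fnz)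
    then have "coeff (f - p * t) (degree f) = 0" by (simp add: dpt)
    moreover have "degree (f - p * t) \<le> degree f"
      using dpt by (metis degree_diff_le order_refl)
    ultimately have "degree (f - p * t) < degree f"
      using False p(3)
      by (metis degree_0 le_neq_implies_less leading_coeff_0_iff linorder_not_less order_less_le_trans)
    moreover have "f - p * t \<in> polys_over R"
      using t p(1) less.prems by (intro diff_polys_over mult_polys_over)
    ultimately obtain g h where gh: "g \<in> polys_over R" "h \<in> polys_over R"
      "f - p * t = p * g + h" "degree h < degree p"
      using less.hyps by blast
    have "f = p * (g + t) + h" using gh(3) by (simp add: algebra_simps)
    then show ?thesis using gh t by (intro bexI[of _ "g + t"] bexI[of _ h]) (auto intro: add_polys_over)
  qed
qed

end

definition root_mean :: "complex poly \<Rightarrow> complex" where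
  "root_mean p = sum_mset (proots p) / of_nat (degree p)"

locale complex_subfield = complex_subring +
  assumes inverse_closed: "a \<in> R \<Longrightarrow> inverse a \<in> R"
begin

lemma divide_closed: "a \<in> R \<Longrightarrow> b \<in> R \<Longrightarrow> a / b \<in> R"
  by (simp add: divide_inverse mult_closed inverse_closed)

text \<open>
  For a monic polynomial this is irreducibility over \<open>R\<close>, phrased through its complex roots: each root has
  degree \<open>degree p\<close> over \<open>R\<close>.
\<close>
definition irreducible_over :: "complex poly \<Rightarrow> bool" where
  "irreducible_over p \<longleftrightarrow> p \<in> polys_over R \<and> lead_coeff p = 1 \<and> degree p > 0 \<and>
     (\<forall>h x. h \<in> polys_over R \<longrightarrow> degree h < degree p \<longrightarrow> poly p x = 0 \<longrightarrow> poly h x = 0 \<longrightarrow> h = 0)"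

lemma irreducible_over_dvd:
  assumes p: "irreducible_over p" and f: "f \<in> polys_over R" and x: "poly p x = 0" "poly f x = 0"
  shows "\<exists>g\<in>polys_over R. f = p * g"
proof -
  obtain g h where gh: "g \<in> polys_over R" "h \<in> polys_over R" "f = p * g + h" "degree h < degree p"
    using monic_division[OF _ _ _ f, of p] p by (auto simp: irreducible_over_def)
  have "poly h x = 0" using x gh(3) by simp
  then have "h = 0" using p gh x unfolding irreducible_over_def by blast
  then show ?thesis using gh by auto
qed

lemma irreducible_over_rsquarefree:
  assumes p: "irreducible_over p"
  shows "rsquarefree p"
proof -
  have dp: "degree (pderiv p) < degree p" "pderiv p \<noteq> 0"
    using p by (auto simp: irreducible_over_def degree_pderiv pderiv_eq_0_iff)
  have "\<not> (poly p x = 0 \<and> poly (pderiv p) x = 0)" for x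
    using p dp pderiv_polys_over[of p] unfolding irreducible_over_def by blast
  then show ?thesis using rsquarefree_roots by blast
qed

text \<open>
  Such an \<open>f\<close> is a power of \<open>p\<close>: as long as it is not constant, it shares a root with \<open>p\<close>, so \<open>p\<close> can be
  split off.
\<close>
lemma sum_proots_of_same_roots:
  assumes p: "irreducible_over p"
  shows "f \<in> polys_over R \<Longrightarrow> lead_coeff f = 1 \<Longrightarrow> (\<And>x. poly f x = 0 \<Longrightarrow> poly p x = 0) \<Longrightarrow>
    sum_mset (proots f) = of_nat (degree f) * root_mean p"
proof (induction "degree f" arbitrary: f rule: less_induct)
  case less
  show ?case
  proof (cases "degree f = 0")
    case True
    then obtain c where "f = [:c:]" by (rule degree_eq_zeroE)
    then show ?thesis by simp
  next
    case False
    then obtain x where x: "poly f x = 0"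
      using fundamental_theorem_of_algebra constant_degree by metis
    then obtain g where g: "g \<in> polys_over R" "f = p * g"
      using irreducible_over_dvd[OF p less.prems(1) _ x] less.prems(3) by blast
    have nz: "p \<noteq> 0" "g \<noteq> 0" using less.prems(2) g(2) by auto
    have lg: "lead_coeff g = 1" using p less.prems(2) g(2)
      by (simp add: lead_coeff_mult irreducible_over_def)
    have dp: "degree p > 0" using p by (simp add: irreducible_over_def)
    have df: "degree f = degree p + degree g" using nz g(2) by (simp add: degree_mult_eq)
    have "sum_mset (proots g) = of_nat (degree g) * root_mean p"
      using less.hyps[of g] df dp g lg less.prems(3) by simp
    moreover have "sum_mset (proots p) = of_nat (degree p) * root_mean p"
      unfolding root_mean_def using dp
      by (metis nonzero_mult_div_cancel_left of_nat_0_eq_iff order_less_irrefl times_divide_eq_right)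
    moreover have "proots f = proots p + proots g" using nz by (simp add: g(2) proots_mult)
    ultimately show ?thesis by (simp add: df distrib_right)
  qed
qed

end

section \<open>Linear relations between conjugates, by traces\<close>

lemma trace_mult_commute:
  fixes A B :: "'a :: comm_semiring_1 mat"
  assumes "A \<in> carrier_mat n n" "B \<in> carrier_mat n n"
  shows "(\<Sum>i<n. (A * B) $$ (i, i)) = (\<Sum>i<n. (B * A) $$ (i, i))"
proof -
  have "(\<Sum>i<n. (A * B) $$ (i, i)) = (\<Sum>i<n. \<Sum>j<n. A $$ (i, j) * B $$ (j, i))"
    using assms by (simp add: scalar_prod_def atLeast0LessThan)
  also have "\<dots> = (\<Sum>j<n. \<Sum>i<n. B $$ (j, i) * A $$ (i, j))"
    by (subst sum.swap) (simp add: mult.commute)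
  also have "\<dots> = (\<Sum>i<n. (B * A) $$ (i, i))"
    using assms by (simp add: scalar_prod_def atLeast0LessThan)
  finally show ?thesis .
qed

lemma trace_eq_sum_proots_char_poly:
  fixes A :: "complex mat"
  assumes A: "A \<in> carrier_mat n n"
  shows "(\<Sum>i<n. A $$ (i, i)) = sum_mset (proots (char_poly A))"
proof -
  obtain es where es: "char_poly A = (\<Prod>a\<leftarrow>es. [:- a, 1:])"
    using char_poly_factorized[OF A] by blast
  obtain B where B: "B \<in> carrier_mat n n" "upper_triangular B" "similar_mat A B"
    using schur_decomposition_exists[OF A es] by blast
  obtain P Q where w: "similar_mat_wit A B P Q" using B(3) unfolding similar_mat_def by blast
  note PQ = similar_mat_witD2[OF A w]
  have "(\<Sum>i<n. A $$ (i, i)) = (\<Sum>i<n. ((P * B) * Q) $$ (i, i))" using PQ(3) by simp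
  also have "\<dots> = (\<Sum>i<n. (Q * (P * B)) $$ (i, i))"
    using PQ by (intro trace_mult_commute) auto
  also have "Q * (P * B) = B"
    using PQ by (subst assoc_mult_mat[symmetric, of _ n n _ n _ n]) auto
  finally have "(\<Sum>i<n. A $$ (i, i)) = sum_list (diag_mat B)"
    using B(1) by (simp add: diag_mat_def interv_sum_list_conv_sum_set_nat atLeast0LessThan)
  moreover have "char_poly A = (\<Prod>a\<leftarrow>diag_mat B. [:- a, 1:])"
    using char_poly_similar[OF B(3)] char_poly_upper_triangular[OF B(1,2)] by simp
  moreover have "proots (\<Prod>a\<leftarrow>as. [:- a, 1:]) = mset as" for as :: "complex list"
  proof (induction as)
    case (Cons a as)
    have "(\<Prod>a\<leftarrow>as. [:- a, 1:]) \<noteq> 0" by (auto simp: prod_list_zero_iff)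
    then have "proots ([:- a, 1:] * (\<Prod>a\<leftarrow>as. [:- a, 1:])) = proots [:- a, 1:] + mset as"
      using Cons by (subst proots_mult) auto
    then show ?case by simp
  qed simp
  ultimately show ?thesis by (simp add: sum_mset_sum_list)
qed


context complex_subfield
begin

definition span_over :: "complex set \<Rightarrow> complex set" where
  "span_over B = {\<Sum>b\<in>B. c b * b | c. \<forall>b\<in>B. c b \<in> R}"

definition independent_over :: "complex set \<Rightarrow> bool" where
  "independent_over B \<longleftrightarrow>
     (\<forall>c. (\<forall>b\<in>B. c b \<in> R) \<longrightarrow> (\<Sum>b\<in>B. c b * b) = 0 \<longrightarrow> (\<forall>b\<in>B. c b = 0))"

lemma span_overI: "(\<And>b. b \<in> B \<Longrightarrow> c b \<in> R) \<Longrightarrow> z = (\<Sum>b\<in>B. c b * b) \<Longrightarrow> z \<in> span_over B"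
  by (auto simp: span_over_def)

lemma span_overE:
  assumes "z \<in> span_over B"
  obtains c where "\<And>b. b \<in> B \<Longrightarrow> c b \<in> R" "z = (\<Sum>b\<in>B. c b * b)"
  using assms by (auto simp: span_over_def)

lemma span_over_base:
  assumes "finite B" "b \<in> B"
  shows "b \<in> span_over B"
proof (rule span_overI)
  show "(if b' = b then 1 else 0) \<in> R" for b' :: complex
    by (simp add: zero_closed one_closed)
  show "b = (\<Sum>b'\<in>B. (if b' = b then 1 else 0) * b')"
    using assms by (simp add: if_distrib if_distribR cong: if_cong)
qed

lemma span_over_add:
  assumes "y \<in> span_over B" "z \<in> span_over B"
  shows "y + z \<in> span_over B"
proof -
  obtain c where c: "\<And>b. b \<in> B \<Longrightarrow> c b \<in> R" "y = (\<Sum>b\<in>B. c b * b)" using assms(1) by (rule span_overE) blast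
  obtain d where d: "\<And>b. b \<in> B \<Longrightarrow> d b \<in> R" "z = (\<Sum>b\<in>B. d b * b)" using assms(2) by (rule span_overE) blast
  show ?thesis
    by (rule span_overI[where c = "\<lambda>b. c b + d b"])
      (auto simp: c d add_closed sum.distrib algebra_simps)
qed

lemma span_over_scale:
  assumes "a \<in> R" "y \<in> span_over B"
  shows "a * y \<in> span_over B"
proof -
  obtain c where c: "\<And>b. b \<in> B \<Longrightarrow> c b \<in> R" "y = (\<Sum>b\<in>B. c b * b)" using assms(2) by (rule span_overE) blast
  show ?thesis
    by (rule span_overI[where c = "\<lambda>b. a * c b"])
      (auto simp: c assms(1) mult_closed sum_distrib_left algebra_simps)
qed

lemma span_over_zero: "0 \<in> span_over B"
  by (rule span_overI[where c = "\<lambda>_. 0"]) (auto simp: zero_closed)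

lemma span_over_sum:
  "(\<And>i. i \<in> I \<Longrightarrow> f i \<in> span_over B) \<Longrightarrow> sum f I \<in> span_over B"
  by (induction I rule: infinite_finite_induct) (auto intro: span_over_add span_over_zero)

lemma span_over_subset:
  assumes "B \<subseteq> span_over C"
  shows "span_over B \<subseteq> span_over C"
proof
  fix z assume "z \<in> span_over B"
  then obtain c where c: "\<And>b. b \<in> B \<Longrightarrow> c b \<in> R" "z = (\<Sum>b\<in>B. c b * b)"
    by (rule span_overE) blast
  show "z \<in> span_over C"
    unfolding c(2) using c(1) assms by (intro span_over_sum span_over_scale) auto
qed

lemma exists_independent_spanning_subset:
  assumes "finite B"
  shows "\<exists>C\<subseteq>B. independent_over C \<and> B \<subseteq> span_over C"
proof -
  \<comment> \<open>A spanning subset of least cardinality is independent.\<close>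
  define good where "good C \<longleftrightarrow> C \<subseteq> B \<and> B \<subseteq> span_over C" for C
  have "good B" using span_over_base[OF assms] by (auto simp: good_def)
  then obtain C where C: "good C" "\<And>D. good D \<Longrightarrow> card C \<le> card D"
    using ex_has_least_nat[of good B card] by blast
  have finC: "finite C" using C(1) assms finite_subset by (auto simp: good_def)
  have "independent_over C"
    unfolding independent_over_def
  proof (intro allI impI ballI, rule ccontr)
    fix c b assume c: "\<forall>b\<in>C. c b \<in> R" "(\<Sum>b\<in>C. c b * b) = 0" and b: "b \<in> C" "c b \<noteq> 0"
    have "c b * b + (\<Sum>b'\<in>C - {b}. c b' * b') = 0"
      using c(2) sum.remove[OF finC b(1), of "\<lambda>b. c b * b"] by simp
    then have "b = (- inverse (c b)) * (\<Sum>b'\<in>C - {b}. c b' * b')"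
      using b(2) by (simp add: field_simps eq_neg_iff_add_eq_0)
    also have "\<dots> \<in> span_over (C - {b})"
      using c(1) b(1)
      by (intro span_over_scale span_over_sum span_over_base uminus_closed inverse_closed)
        (auto simp: finC)
    finally have "C \<subseteq> span_over (C - {b})"
      using span_over_base[of "C - {b}"] finC by auto
    then have "good (C - {b})"
      using C(1) span_over_subset unfolding good_def by blast
    from C(2)[OF this] show False
      using finC b(1) by (metis card_Diff1_less linorder_not_less)
  qed
  then show ?thesis using C(1) by (auto simp: good_def)
qed

text \<open>
  Monomials in the elements of \<open>S\<close> with bounded exponents span a space stable under multiplication by \<open>S\<close>,
  because a monic equation rewrites the first power that leaves the bounds. This space is the finite-dimensional
  stage on which traces are taken.
\<close>
lemma exists_finite_module:
  assumes "finite S"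
    and "\<And>x. x \<in> S \<Longrightarrow> \<exists>p\<in>polys_over R. lead_coeff p = 1 \<and> degree p > 0 \<and> poly p x = 0"
  shows "\<exists>B. finite B \<and> 1 \<in> B \<and> (\<forall>x\<in>S. \<forall>b\<in>B. x * b \<in> span_over B)"
  using assms
proof (induction S rule: finite_induct)
  case empty
  then show ?case by (intro exI[of _ "{1}"]) auto
next
  case (insert x S)
  then obtain B where B: "finite B" "1 \<in> B" "\<forall>y\<in>S. \<forall>b\<in>B. y * b \<in> span_over B" by auto
  obtain p where p: "p \<in> polys_over R" "lead_coeff p = 1" "degree p > 0" "poly p x = 0"
    using insert.prems by blast
  define C where "C = (\<lambda>(k, b). x ^ k * b) ` ({..<degree p} \<times> B)"
  have fin: "finite C" unfolding C_def using B(1) by blast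
  have CI: "x ^ k * b \<in> C" if "k < degree p" "b \<in> B" for k b using that by (auto simp: C_def)
  have base: "x ^ k * b \<in> span_over C" if "k < degree p" "b \<in> B" for k b
    using span_over_base[OF fin CI[OF that]] .
  have one: "1 \<in> C" using CI[of 0 1] p(3) B(2) by simp
  have xstep: "x * (x ^ k * b) \<in> span_over C" if k: "k < degree p" and b: "b \<in> B" for k b
  proof (cases "Suc k < degree p")
    case True
    then show ?thesis using base[of "Suc k" b] b by (simp add: mult.assoc)
  next
    case False
    then have deg: "degree p = Suc k" using k by simp
    have "0 = (\<Sum>i<degree p. coeff p i * x ^ i) + x ^ degree p"
      using p(2,4) by (simp add: poly_altdef lessThan_Suc_atMost[symmetric])
    then have "x ^ Suc k = (\<Sum>i<degree p. (- coeff p i) * x ^ i)"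
      by (simp add: deg[symmetric] sum_negf eq_neg_iff_add_eq_0 add.commute)
    then have "x * (x ^ k * b) = (\<Sum>i<degree p. (- coeff p i) * (x ^ i * b))"
      by (simp add: mult.assoc[symmetric] sum_distrib_right)
    also have "\<dots> \<in> span_over C"
      using p(1) b
      by (intro span_over_sum span_over_scale base uminus_closed) (auto simp: polys_over_def)
    finally show ?thesis .
  qed
  have ystep: "y * (x ^ k * b) \<in> span_over C" if y: "y \<in> S" and k: "k < degree p" and b: "b \<in> B" for y k b
  proof -
    have "y * b \<in> span_over B" using B(3) y b by blast
    then obtain c where c: "\<And>b'. b' \<in> B \<Longrightarrow> c b' \<in> R" "y * b = (\<Sum>b'\<in>B. c b' * b')"
      by (rule span_overE) blast
    have "y * (x ^ k * b) = x ^ k * (y * b)" by (simp add: ac_simps)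
    also have "\<dots> = (\<Sum>b'\<in>B. c b' * (x ^ k * b'))"
      unfolding c(2) by (simp add: sum_distrib_left ac_simps)
    also have "\<dots> \<in> span_over C"
      using c(1) k by (intro span_over_sum span_over_scale base) auto
    finally show ?thesis .
  qed
  show ?case
    using fin one xstep ystep by (intro exI[of _ C]) (auto simp: C_def)
qed

text \<open>
  \<open>A\<close> is the matrix, with entries in the subfield, of multiplication by \<open>x\<close> in terms of \<open>b\<close>; thus the
  vector \<open>b\<close> satisfies \<open>A b = x b\<close>.
\<close>
definition represents :: "complex mat \<Rightarrow> nat \<Rightarrow> (nat \<Rightarrow> complex) \<Rightarrow> complex \<Rightarrow> bool" where
  "represents A N b x \<longleftrightarrow> A \<in> carrier_mat N N \<and> (\<forall>i<N. \<forall>j<N. A $$ (i, j) \<in> R) \<and>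
     (\<forall>i<N. x * b i = (\<Sum>j<N. A $$ (i, j) * b j))"

lemma exists_representing_matrix:
  assumes b: "bij_betw b {..<N} B" and x: "\<forall>y\<in>B. x * y \<in> span_over B"
  shows "\<exists>A. represents A N b x"
proof -
  have "\<forall>i\<in>{..<N}. \<exists>c. (\<forall>y\<in>B. c y \<in> R) \<and> x * b i = (\<Sum>y\<in>B. c y * y)"
    using x bij_betwE[OF b] by (fast elim: span_overE)
  then obtain c where c: "\<And>i. i < N \<Longrightarrow> (\<forall>y\<in>B. c i y \<in> R) \<and> x * b i = (\<Sum>y\<in>B. c i y * y)"
    by (metis lessThan_iff)
  have "(\<Sum>y\<in>B. c i y * y) = (\<Sum>j<N. c i (b j) * b j)" for i
    using sum.reindex_bij_betw[OF b, of "\<lambda>y. c i y * y"] by simp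
  then have "represents (Matrix.mat N N (\<lambda>(i, j). c i (b j))) N b x"
    using c bij_betwE[OF b] by (auto simp: represents_def)
  then show ?thesis by blast
qed

lemma represents_power:
  assumes A: "represents A N b x"
  shows "represents (A ^\<^sub>m k) N b (x ^ k)"
proof (induction k)
  case 0
  show ?case
    using A by (auto simp: represents_def zero_closed one_closed if_distrib if_distribR cong: if_cong)
next
  case (Suc k)
  have carrier: "A \<in> carrier_mat N N" "A ^\<^sub>m k \<in> carrier_mat N N"
    using A by (auto simp: represents_def)
  have entry: "(A ^\<^sub>m Suc k) $$ (i, j) = (\<Sum>l<N. (A ^\<^sub>m k) $$ (i, l) * A $$ (l, j))"
    if "i < N" "j < N" for i j
    using that carrier by (simp add: scalar_prod_def atLeast0LessThan)
  have "x ^ Suc k * b i = (\<Sum>j<N. (A ^\<^sub>m Suc k) $$ (i, j) * b j)" if i: "i < N" for i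
  proof -
    have "x ^ Suc k * b i = x * (\<Sum>l<N. (A ^\<^sub>m k) $$ (i, l) * b l)"
      using Suc i by (simp add: represents_def)
    also have "\<dots> = (\<Sum>l<N. (A ^\<^sub>m k) $$ (i, l) * (x * b l))"
      by (simp add: sum_distrib_left ac_simps)
    also have "\<dots> = (\<Sum>l<N. \<Sum>j<N. (A ^\<^sub>m k) $$ (i, l) * A $$ (l, j) * b j)"
      using A by (simp add: represents_def sum_distrib_left ac_simps)
    also have "\<dots> = (\<Sum>j<N. \<Sum>l<N. (A ^\<^sub>m k) $$ (i, l) * A $$ (l, j) * b j)"
      by (rule sum.swap)
    also have "\<dots> = (\<Sum>j<N. (A ^\<^sub>m Suc k) $$ (i, j) * b j)"
      using i by (intro sum.cong refl) (simp add: entry sum_distrib_right del: pow_mat.simps)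
    finally show ?thesis .
  qed
  moreover have "(A ^\<^sub>m Suc k) $$ (i, j) \<in> R" if "i < N" "j < N" for i j
    using that A Suc by (simp only: entry) (auto simp: represents_def intro!: sum_closed mult_closed)
  ultimately show ?case
    using carrier pow_carrier_mat[OF carrier(1), of "Suc k"] by (auto simp: represents_def)
qed

lemma independent_overD:
  assumes B: "independent_over B" and b: "bij_betw b {..<N} B"
    and c: "\<And>j. j < N \<Longrightarrow> c j \<in> R" "(\<Sum>j<N. c j * b j) = 0" and j: "j < N"
  shows "c j = 0"
proof -
  define d where "d = (\<lambda>y. c (inv_into {..<N} b y))"
  have d: "d (b j) = c j" if "j < N" for j
    using that b by (simp add: d_def bij_betw_def inv_into_f_f)
  have "(\<Sum>y\<in>B. d y * y) = (\<Sum>j<N. d (b j) * b j)"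
    using sum.reindex_bij_betw[OF b, of "\<lambda>y. d y * y"] by simp
  then have "(\<Sum>y\<in>B. d y * y) = 0" using c(2) d by simp
  moreover have "d y \<in> R" if "y \<in> B" for y
    using that b c(1) d by (auto simp: bij_betw_def)
  ultimately have "d (b j) = 0"
    using B bij_betwE[OF b] j unfolding independent_over_def by blast
  then show ?thesis using d j by simp
qed

text \<open>
  The matrix \<open>p(A)\<close> maps the vector \<open>b\<close> to \<open>p(x) b = 0\<close>. Its entries lie in the subfield, over which the
  entries of \<open>b\<close> are independent, so \<open>p(A) = 0\<close>, and then \<open>p\<close> vanishes on the spectrum of \<open>A\<close>.
\<close>
lemma eigenvalue_of_representing_matrix:
  assumes B: "independent_over B" "bij_betw b {..<N} B" and A: "represents A N b x"
    and p: "p \<in> polys_over R" "poly p x = 0" and e: "eigenvalue A e"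
  shows "poly p e = 0"
proof -
  have carrier: "A \<in> carrier_mat N N" "A ^\<^sub>m k \<in> carrier_mat N N" for k
    using A by (auto simp: represents_def)
  define E where "E i j = (\<Sum>k\<le>degree p. coeff p k * (A ^\<^sub>m k) $$ (i, j))" for i j
  have E0: "E i j = 0" if i: "i < N" and j: "j < N" for i j
  proof (rule independent_overD[OF B _ _ j])
    show "E i j \<in> R" if "j < N" for j
      using that i p(1) represents_power[OF A]
      by (auto simp: E_def polys_over_def represents_def intro!: sum_closed mult_closed)
    have "(\<Sum>j<N. E i j * b j) = (\<Sum>k\<le>degree p. coeff p k * (\<Sum>j<N. (A ^\<^sub>m k) $$ (i, j) * b j))"
      unfolding E_def by (simp add: sum_distrib_left sum_distrib_right mult.assoc) (rule sum.swap)
    also have "\<dots> = (\<Sum>k\<le>degree p. coeff p k * (x ^ k * b i))"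
      using i represents_power[OF A] by (simp add: represents_def)
    also have "\<dots> = poly p x * b i"
      by (simp add: poly_altdef sum_distrib_right mult.assoc)
    finally show "(\<Sum>j<N. E i j * b j) = 0" using p(2) by simp
  qed
  obtain v where v: "v \<in> carrier_vec N" "v \<noteq> 0\<^sub>v N" "A *\<^sub>v v = e \<cdot>\<^sub>v v"
    using e carrier(1) unfolding eigenvalue_def eigenvector_def by auto
  obtain i where i: "i < N" "v $ i \<noteq> 0"
    using v(1,2) by (metis carrier_vecD eq_vecI index_zero_vec)
  have power_v: "A ^\<^sub>m k *\<^sub>v v = e ^ k \<cdot>\<^sub>v v" for k
    using eigenvector_pow[OF carrier(1), of v e k] v carrier(1) by (simp add: eigenvector_def)
  have pow: "(\<Sum>j<N. (A ^\<^sub>m k) $$ (i, j) * v $ j) = e ^ k * v $ i" for k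
  proof -
    have "(A ^\<^sub>m k *\<^sub>v v) $ i = (e ^ k \<cdot>\<^sub>v v) $ i" by (simp only: power_v)
    moreover have "dim_row (A ^\<^sub>m k) = N" "dim_col (A ^\<^sub>m k) = N" using carrier(2)[of k] by auto
    ultimately show ?thesis using i v(1) by (simp add: scalar_prod_def atLeast0LessThan)
  qed
  have "0 = (\<Sum>j<N. E i j * v $ j)" using E0 i by simp
  also have "\<dots> = (\<Sum>k\<le>degree p. coeff p k * (\<Sum>j<N. (A ^\<^sub>m k) $$ (i, j) * v $ j))"
    unfolding E_def by (simp add: sum_distrib_left sum_distrib_right mult.assoc) (rule sum.swap)
  also have "\<dots> = poly p e * v $ i"
    by (simp add: pow poly_altdef sum_distrib_right mult.assoc)
  finally show ?thesis using i by simp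
qed

text \<open>
  The characteristic polynomial has coefficients in the subfield and no other roots than those of \<open>p\<close>,
  so it is a power of \<open>p\<close>, and the trace is the sum of its roots.
\<close>
lemma trace_of_representing_matrix:
  assumes B: "independent_over B" "bij_betw b {..<N} B" and A: "represents A N b x"
    and p: "irreducible_over p" "poly p x = 0"
  shows "(\<Sum>i<N. A $$ (i, i)) = of_nat N * root_mean p"
proof -
  have carrier: "A \<in> carrier_mat N N" using A by (simp add: represents_def)
  have "sum_mset (proots (char_poly A)) = of_nat (degree (char_poly A)) * root_mean p"
  proof (rule sum_proots_of_same_roots[OF p(1)])
    show "char_poly A \<in> polys_over R"
      using A by (intro char_poly_polys_over[OF carrier]) (auto simp: represents_def)
    show "lead_coeff (char_poly A) = 1" using degree_monic_char_poly[OF carrier] by simp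
    show "poly p e = 0" if "poly (char_poly A) e = 0" for e
      using that eigenvalue_of_representing_matrix[OF B A _ p(2)] p(1)
      by (simp add: irreducible_over_def eigenvalue_root_char_poly[OF carrier])
  qed
  then show ?thesis
    using degree_monic_char_poly[OF carrier] trace_eq_sum_proots_char_poly[OF carrier] by simp
qed

text \<open>
  A substitute for averaging the relation over a Galois group. With respect to a common basis, a relation
  between numbers is the same relation between the matrices that represent them; now take the trace.
\<close>
theorem linear_relation_root_means:
  assumes I: "finite I"
    and p: "\<And>i. i \<in> I \<Longrightarrow> irreducible_over (p i)" "\<And>i. i \<in> I \<Longrightarrow> poly (p i) (x i) = 0"
    and k: "\<And>i. i \<in> I \<Longrightarrow> k i \<in> R" "c \<in> R" and rel: "(\<Sum>i\<in>I. k i * x i) = c"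
  shows "(\<Sum>i\<in>I. k i * root_mean (p i)) = c"
proof -
  have "\<exists>q\<in>polys_over R. lead_coeff q = 1 \<and> degree q > 0 \<and> poly q y = 0" if y: "y \<in> x ` I" for y
  proof -
    obtain i where i: "i \<in> I" "y = x i" using y by blast
    show ?thesis using p(1)[OF i(1)] p(2)[OF i(1)] i(2) by (auto simp: irreducible_over_def)
  qed
  from exists_finite_module[OF finite_imageI[OF I] this]
  obtain B0 where B0: "finite B0" "1 \<in> B0" "\<forall>y\<in>x ` I. \<forall>b\<in>B0. y * b \<in> span_over B0"
    by blast
  obtain B where B: "B \<subseteq> B0" "independent_over B" "B0 \<subseteq> span_over B"
    using exists_independent_spanning_subset[OF B0(1)] by blast
  have finB: "finite B" using B(1) B0(1) finite_subset by blast
  have closed: "x i * b \<in> span_over B" if "i \<in> I" "b \<in> B" for i b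
    using that B B0(3) span_over_subset[OF B(3)] by blast
  have "B \<noteq> {}" using B(3) B0(2) by (auto simp: span_over_def)
  define N where "N = card B"
  have N: "N > 0" using \<open>B \<noteq> {}\<close> finB by (simp add: N_def card_gt_0_iff)
  obtain b where b: "bij_betw b {..<N} B"
    using ex_bij_betw_nat_finite[OF finB] by (auto simp: N_def atLeast0LessThan)
  have "\<forall>i\<in>I. \<exists>A. represents A N b (x i)"
    using exists_representing_matrix[OF b] closed by blast
  then obtain A where A: "\<And>i. i \<in> I \<Longrightarrow> represents (A i) N b (x i)"
    by (auto dest!: bchoice)
  have diag: "(\<Sum>i\<in>I. k i * A i $$ (l, l)) = c" if l: "l < N" for l
  proof -
    define d where "d j = (\<Sum>i\<in>I. k i * A i $$ (l, j)) - (if j = l then c else 0)" for j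
    have "d l = 0"
    proof (rule independent_overD[OF B(2) b _ _ l])
      show "d j \<in> R" if "j < N" for j
        using that l A k
        by (auto simp: d_def represents_def intro!: diff_closed sum_closed mult_closed zero_closed)
      have "(\<Sum>j<N. d j * b j) =
          (\<Sum>j<N. (\<Sum>i\<in>I. k i * A i $$ (l, j)) * b j) - (\<Sum>j<N. (if j = l then c else 0) * b j)"
        by (simp only: d_def left_diff_distrib sum_subtractf)
      also have "(\<Sum>j<N. (if j = l then c else 0) * b j) = c * b l"
        using l by (simp add: if_distrib[of "\<lambda>z. z * _"] cong: if_cong)
      also have "(\<Sum>j<N. (\<Sum>i\<in>I. k i * A i $$ (l, j)) * b j) = (\<Sum>i\<in>I. k i * (\<Sum>j<N. A i $$ (l, j) * b j))"
        by (simp add: sum_distrib_left sum_distrib_right mult.assoc) (rule sum.swap)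
      also have "\<dots> = (\<Sum>i\<in>I. k i * (x i * b l))"
        using A l by (intro sum.cong) (auto simp: represents_def)
      also have "\<dots> = c * b l"
        by (simp add: rel[symmetric] sum_distrib_right mult.assoc)
      finally show "(\<Sum>j<N. d j * b j) = 0" by simp
    qed
    then show ?thesis by (simp add: d_def)
  qed
  have trace: "(\<Sum>l<N. A i $$ (l, l)) = of_nat N * root_mean (p i)" if "i \<in> I" for i
    using trace_of_representing_matrix[OF B(2) b A[OF that] p(1)[OF that] p(2)[OF that]] .
  have "of_nat N * (\<Sum>i\<in>I. k i * root_mean (p i)) = (\<Sum>i\<in>I. k i * (\<Sum>l<N. A i $$ (l, l)))"
    by (simp add: trace sum_distrib_left[of "of_nat N"] mult.left_commute)
  also have "\<dots> = (\<Sum>l<N. \<Sum>i\<in>I. k i * A i $$ (l, l))"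
    by (simp add: sum_distrib_left) (rule sum.swap)
  also have "\<dots> = of_nat N * c" by (simp add: diag)
  finally show ?thesis using N by simp
qed

end

section \<open>Parameters with transcendental roots\<close>

lemma sum_proots_eq_coeff:
  fixes p :: "complex poly"
  assumes "lead_coeff p = 1" "degree p > 0"
  shows "sum_mset (proots p) = - coeff p (degree p - 1)"
proof -
  have vieta: "degree (\<Prod>x\<in>#A. [:- x, 1:]) = size A \<and> lead_coeff (\<Prod>x\<in>#A. [:- x, 1:]) = 1 \<and>
    (A \<noteq> {#} \<longrightarrow> coeff (\<Prod>x\<in>#A. [:- x, 1:]) (size A - 1) = - sum_mset A)" for A :: "complex multiset"
  proof (induction A)
    case (add x A)
    let ?r = "\<Prod>x\<in>#A. [:- x, 1:]"
    have r: "?r \<noteq> 0" using add.IH by auto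
    have "degree ([:- x, 1:] * ?r) = Suc (size A)"
      using add.IH r by (subst degree_mult_eq) auto
    moreover have "lead_coeff ([:- x, 1:] * ?r) = 1"
    proof -
      have "lead_coeff ?r = 1" using add.IH by blast
      then show ?thesis by (simp only: lead_coeff_mult) simp
    qed
    moreover have "coeff ([:- x, 1:] * ?r) (size A) = - x - sum_mset A"
    proof (cases "A = {#}")
      case False
      then obtain k where k: "size A = Suc k" by (cases "size A") auto
      then have "coeff ?r (Suc k) = 1" "coeff ?r k = - sum_mset A" using add.IH False by auto
      then show ?thesis by (simp add: k)
    qed simp
    ultimately show ?case by simp
  qed simp
  have p: "p = (\<Prod>x\<in>#proots p. [:- x, 1:])"
    using complex_poly_decompose_multiset[of p] assms(1) by simp
  have "size (proots p) = degree p" by (rule size_proots_complex)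
  then show ?thesis
    using vieta[of "proots p"] p assms(2) by auto
qed

lemma countable_algebraic: "countable {x :: complex. algebraic x}"
proof -
  have "{x :: complex. algebraic x} \<subseteq> (\<Union>as\<in>{as :: int list. Poly (map of_int as) \<noteq> (0 :: complex poly)}.
      {x :: complex. poly (Poly (map of_int as)) x = 0})"
  proof
    fix x :: complex assume "x \<in> {x. algebraic x}"
    then have "algebraic x" by simp
    then obtain p :: "complex poly" where p: "\<And>i. coeff p i \<in> \<int>" "p \<noteq> 0" "poly p x = 0"
      by (rule algebraicE) blast
    have "\<forall>i. \<exists>k. coeff p i = of_int k" using p(1) by (blast elim: Ints_cases)
    from choice[OF this] obtain a where a: "\<And>i. coeff p i = of_int (a i)" by blast
    define as where "as = map a [0..<Suc (degree p)]"
    have "coeffs p = map of_int as"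
      using p(2) by (simp add: coeffs_def a as_def)
    then have "Poly (map of_int as) = p"
      using Poly_coeffs[of p] by simp
    then show "x \<in> (\<Union>as\<in>{as :: int list. Poly (map of_int as) \<noteq> (0 :: complex poly)}.
      {x :: complex. poly (Poly (map of_int as)) x = 0})"
      using p(2,3) by (intro UN_I[of as]) simp_all
  qed
  moreover have "countable (\<Union>as\<in>{as :: int list. Poly (map of_int as) \<noteq> (0 :: complex poly)}.
      {x :: complex. poly (Poly (map of_int as)) x = 0})"
    by (rule countable_UN[OF countableI_type]) (auto intro: countable_finite poly_roots_finite)
  ultimately show ?thesis by (rule countable_subset)
qed

interpretation integers: complex_subring "\<int> :: complex set"
  by unfold_locales auto

lemma algebraic_polys_over: "p \<in> polys_over \<int> \<Longrightarrow> p \<noteq> 0 \<Longrightarrow> poly p x = 0 \<Longrightarrow> algebraic x"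
  by (auto simp: polys_over_def intro: algebraicI)

text \<open>
  Comaximality in place of \<open>coprime\<close> gives the Bezout identity directly, which is all that
  divisibility and the absence of common roots require.
\<close>
definition comaximal :: "complex poly \<Rightarrow> complex poly \<Rightarrow> bool" where
  "comaximal U V \<longleftrightarrow> (\<exists>a b. a * U + b * V = 1)"

lemma comaximal_no_common_root: "comaximal U V \<Longrightarrow> poly U x = 0 \<Longrightarrow> poly V x \<noteq> 0"
  unfolding comaximal_def
  by (metis add_0 mult_zero_right poly_1 poly_add poly_mult zero_neq_one)

lemma comaximal_dvd_mult_power:
  assumes "comaximal U V" "U dvd c * V ^ k"
  shows "U dvd c"
  using assms(2)
proof (induction k)
  case (Suc k)
  obtain a b where ab: "a * U + b * V = 1" using assms(1) by (auto simp: comaximal_def)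
  have "c * V ^ k = (a * U + b * V) * (c * V ^ k)" by (simp add: ab)
  also have "\<dots> = U * (a * (c * V ^ k)) + b * (c * V ^ Suc k)" by (simp add: algebra_simps)
  finally have "c * V ^ k = U * (a * (c * V ^ k)) + b * (c * V ^ Suc k)" .
  moreover have "U dvd b * (c * V ^ Suc k)" using Suc.prems by (rule dvd_mult)
  ultimately have "U dvd c * V ^ k" by (metis dvd_add dvd_triv_left)
  then show ?case by (rule Suc.IH)
qed simp

text \<open>
  Modulo \<open>U\<close> only the term \<open>B 0 * V ^ d\<close> survives, so \<open>U\<close> divides \<open>B 0\<close>, which is impossible by degree unless
  \<open>B 0 = 0\<close>. Dividing by \<open>U\<close> lowers \<open>d\<close>.
\<close>
lemma homogeneous_form_eq_0:
  assumes UV: "comaximal U V"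
  shows "(\<And>j. degree (B j) < degree U) \<Longrightarrow> (\<Sum>j\<le>d. B j * U ^ j * V ^ (d - j)) = 0 \<Longrightarrow>
    j \<le> d \<Longrightarrow> B j = 0"
proof (induction d arbitrary: B j)
  case 0
  then show ?case by simp
next
  case (Suc d)
  have split: "B 0 * V ^ Suc d + U * (\<Sum>j\<le>d. B (Suc j) * U ^ j * V ^ (d - j)) = 0"
    using Suc.prems(2) by (simp add: sum.atMost_Suc_shift sum_distrib_left algebra_simps del: sum.atMost_Suc)
  then have "B 0 * V ^ Suc d = U * (- (\<Sum>j\<le>d. B (Suc j) * U ^ j * V ^ (d - j)))"
    by (simp add: eq_neg_iff_add_eq_0)
  then have "U dvd B 0 * V ^ Suc d" by (metis dvd_triv_left)
  then have "U dvd B 0" by (rule comaximal_dvd_mult_power[OF UV])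
  then have B0: "B 0 = 0" using Suc.prems(1)[of 0] dvd_imp_degree_le by (metis leD)
  have "U \<noteq> 0" using Suc.prems(1)[of 0] by auto
  then have "(\<Sum>j\<le>d. B (Suc j) * U ^ j * V ^ (d - j)) = 0" using split B0 by simp
  then have "B (Suc i) = 0" if "i \<le> d" for i using Suc.IH[of "\<lambda>j. B (Suc j)" i] Suc.prems(1) that by blast
  then show ?case using B0 Suc.prems(3) by (cases j) auto
qed

text \<open>
  The field \<open>\<rat>(q)\<close>. Integral numerators and denominators suffice, and they match the
  definition of \<open>algebraic\<close>.
\<close>
definition field_generated_by :: "complex \<Rightarrow> complex set" where
  "field_generated_by q = {poly a q / poly b q | a b. a \<in> polys_over \<int> \<and> b \<in> polys_over \<int> \<and> poly b q \<noteq> 0}"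

lemma field_generated_byI:
  "a \<in> polys_over \<int> \<Longrightarrow> b \<in> polys_over \<int> \<Longrightarrow> poly b q \<noteq> 0 \<Longrightarrow> z = poly a q / poly b q \<Longrightarrow>
    z \<in> field_generated_by q"
  by (auto simp: field_generated_by_def)

lemma field_generated_byE:
  assumes "z \<in> field_generated_by q"
  obtains a b where "a \<in> polys_over \<int>" "b \<in> polys_over \<int>" "poly b q \<noteq> 0" "z = poly a q / poly b q"
  using assms by (auto simp: field_generated_by_def)

lemma complex_subfield_generated_by: "complex_subfield (field_generated_by q)"
proof
  show "1 \<in> field_generated_by q"
    by (rule field_generated_byI[of 1 1]) (auto intro: integers.one_polys_over)
next
  fix y z assume y: "y \<in> field_generated_by q" and z: "z \<in> field_generated_by q"
  obtain a b where ab: "a \<in> polys_over \<int>" "b \<in> polys_over \<int>" "poly b q \<noteq> 0" "y = poly a q / poly b q"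
    using y by (rule field_generated_byE)
  obtain c d where cd: "c \<in> polys_over \<int>" "d \<in> polys_over \<int>" "poly d q \<noteq> 0" "z = poly c q / poly d q"
    using z by (rule field_generated_byE)
  note * = ab cd
  show "y - z \<in> field_generated_by q"
    by (rule field_generated_byI[of "a * d - c * b" "b * d"])
      (use * in \<open>auto intro: integers.mult_polys_over integers.diff_polys_over simp: diff_frac_eq\<close>)
  show "y * z \<in> field_generated_by q"
    by (rule field_generated_byI[of "a * c" "b * d"])
      (use * in \<open>auto intro: integers.mult_polys_over\<close>)
next
  fix z assume "z \<in> field_generated_by q"
  then obtain a b where *: "a \<in> polys_over \<int>" "b \<in> polys_over \<int>" "poly b q \<noteq> 0" "z = poly a q / poly b q"
    by (rule field_generated_byE)
  show "inverse z \<in> field_generated_by q"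
  proof (cases "poly a q = 0")
    case True
    then show ?thesis using *
      by (intro field_generated_byI[of 0 1]) (auto intro: integers.one_polys_over integers.zero_polys_over)
  next
    case False
    then show ?thesis using * by (intro field_generated_byI[of b a]) auto
  qed
qed

lemma poly_in_field_generated_by: "a \<in> polys_over \<int> \<Longrightarrow> poly a q \<in> field_generated_by q"
  by (rule field_generated_byI[of a 1]) (auto intro: integers.one_polys_over)

lemma generator_in_field_generated_by: "q \<in> field_generated_by q"
  using poly_in_field_generated_by[of "[:0, 1:]" q]
  by (simp add: integers.pCons_polys_over integers.zero_polys_over)

lemma common_denominator:
  fixes h :: "complex poly"
  assumes h: "h \<in> polys_over (field_generated_by q)"
  obtains A b where "\<And>i. A i \<in> polys_over \<int>" "poly b q \<noteq> 0" "\<And>i. coeff h i * poly b q = poly (A i) q"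
proof -
  have "\<exists>A b. (\<forall>i. A i \<in> polys_over \<int>) \<and> b \<in> polys_over \<int> \<and> poly b q \<noteq> 0 \<and>
    (\<forall>i. coeff h i * poly b q = poly (A i) q)"
    using h
  proof (induction h)
    case 0
    show ?case
      by (intro exI[of _ "\<lambda>_. 0"] exI[of _ 1])
        (auto intro: integers.one_polys_over integers.zero_polys_over)
  next
    case (pCons c h)
    have "c \<in> field_generated_by q" and "h \<in> polys_over (field_generated_by q)"
    proof -
      have "coeff (pCons c h) i \<in> field_generated_by q" for i
        using pCons.prems by (simp add: polys_over_def)
      from this[of 0] this[of "Suc _"] show "c \<in> field_generated_by q" "h \<in> polys_over (field_generated_by q)"
        by (auto simp: polys_over_def)
    qed
    obtain A b where Ab: "\<And>i. A i \<in> polys_over \<int>" "b \<in> polys_over \<int>" "poly b q \<noteq> 0"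
        "\<And>i. coeff h i * poly b q = poly (A i) q"
      using pCons.IH[OF \<open>h \<in> polys_over (field_generated_by q)\<close>] by blast
    obtain a d where ad: "a \<in> polys_over \<int>" "d \<in> polys_over \<int>"
        "poly d q \<noteq> 0" "c = poly a q / poly d q"
      using \<open>c \<in> field_generated_by q\<close> by (rule field_generated_byE)
    note * = Ab ad
    show ?case
      by (intro exI[of _ "case_nat (a * b) (\<lambda>i. A i * d)"] exI[of _ "b * d"])
        (use * in \<open>auto intro: integers.mult_polys_over simp: coeff_pCons split: nat.splits\<close>)
  qed
  then show ?thesis using that by blast
qed

lemma poly_eq_sum_le:
  fixes p :: "'a :: comm_semiring_1 poly"
  assumes "degree p \<le> n"
  shows "poly p x = (\<Sum>i\<le>n. coeff p i * x ^ i)"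
  unfolding poly_altdef using assms by (intro sum.mono_neutral_left) (auto simp: coeff_eq_0)

text \<open>
  A root \<open>x\<close> satisfies \<open>q = U(x) / V(x)\<close>. Substituting this for \<open>q\<close> in an equation of degree less than
  \<open>degree U\<close> for \<open>x\<close> over \<open>\<rat>(q)\<close> and clearing denominators gives an equation for \<open>x\<close> with integer coefficients.
  Since \<open>x\<close> is transcendental, that equation is an identity of polynomials, of the form excluded
  by \<open>homogeneous_form_eq_0\<close>.
\<close>
lemma irreducible_over_pencil:
  assumes U: "U \<in> polys_over \<int>" "lead_coeff U = 1" and V: "V \<in> polys_over \<int>" "degree V < degree U"
    and UV: "comaximal U V"
    and transcendental: "\<And>x. poly (U - smult q V) x = 0 \<Longrightarrow> \<not> algebraic x"
  shows "complex_subfield.irreducible_over (field_generated_by q) (U - smult q V)"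
proof -
  interpret K: complex_subfield "field_generated_by q" by (rule complex_subfield_generated_by)
  define P where "P = U - smult q V"
  have "\<int> \<subseteq> field_generated_by q"
    using K.of_int_closed by (auto simp: Ints_def)
  then have ZK: "p \<in> polys_over (field_generated_by q)" if "p \<in> polys_over \<int>" for p
    using that by (auto simp: polys_over_def)
  have P_over: "P \<in> polys_over (field_generated_by q)"
    unfolding P_def
    by (intro K.diff_polys_over K.smult_polys_over ZK U V generator_in_field_generated_by)
  have lessV: "degree (smult q V) < degree U" using V(2) degree_smult_le le_less_trans by blast
  then have degP: "degree P = degree U"
    unfolding P_def by (metis degree_add_eq_left degree_minus diff_conv_add_uminus)
  have leadP: "lead_coeff P = 1"
    using U(2) coeff_eq_0[OF V(2)] unfolding degP by (simp add: P_def)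
  have "h = 0" if h: "h \<in> polys_over (field_generated_by q)" "degree h < degree P"
    and x: "poly P x = 0" "poly h x = 0" for h x
  proof -
    obtain A b where A: "\<And>i. A i \<in> polys_over \<int>" and b: "poly b q \<noteq> 0"
      and hA: "\<And>i. coeff h i * poly b q = poly (A i) q"
      using common_denominator[OF h(1)] by blast
    define r where "r = degree U"
    define d where "d = Max (degree ` A ` {..<r})"
    have d: "degree (A i) \<le> d" if "i < r" for i
      using that by (auto simp: d_def intro!: Max_ge)
    \<comment> \<open>The numerators of \<open>h\<close>, regrouped by powers of \<open>q\<close>.\<close>
    define B where "B j = (\<Sum>i<r. monom (coeff (A i) j) i)" for j
    have coeffB: "coeff (B j) i = coeff (A i) j" if "i < r" for i j
      using that by (simp add: B_def coeff_sum if_distrib cong: if_cong)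
    have degB: "degree (B j) < degree U" for j
    proof -
      have "degree (B j) \<le> r - 1" unfolding B_def
        by (intro degree_sum_le) (auto intro: order.trans[OF degree_monom_le])
      then show ?thesis using V(2) by (simp add: r_def)
    qed
    \<comment> \<open>The result of substituting \<open>q = U / V\<close> and multiplying by \<open>V ^ d\<close>.\<close>
    define S where "S = (\<Sum>j\<le>d. B j * U ^ j * V ^ (d - j))"
    have "S \<in> polys_over \<int>"
      unfolding S_def B_def using A
      by (intro integers.sum_polys_over integers.mult_polys_over integers.power_polys_over U V
          integers.monom_polys_over) (auto simp: polys_over_def)
    moreover have "poly S x = 0"
    proof -
      have Ux: "poly U x = q * poly V x" using x(1) by (simp add: P_def)
      have "poly S x = (\<Sum>j\<le>d. poly (B j) x * (q * poly V x) ^ j * poly V x ^ (d - j))"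
        by (simp add: S_def poly_sum Ux)
      also have "\<dots> = (\<Sum>j\<le>d. poly V x ^ d * (q ^ j * poly (B j) x))"
      proof (rule sum.cong[OF refl])
        fix j assume "j \<in> {..d}"
        then have "poly V x ^ d = poly V x ^ j * poly V x ^ (d - j)"
          by (simp add: power_add[symmetric])
        then show "poly (B j) x * (q * poly V x) ^ j * poly V x ^ (d - j) = poly V x ^ d * (q ^ j * poly (B j) x)"
          by (simp add: power_mult_distrib)
      qed
      also have "\<dots> = poly V x ^ d * (\<Sum>j\<le>d. \<Sum>i<r. coeff (A i) j * q ^ j * x ^ i)"
        by (simp add: B_def poly_sum poly_monom sum_distrib_left ac_simps)
      also have "(\<Sum>j\<le>d. \<Sum>i<r. coeff (A i) j * q ^ j * x ^ i) = (\<Sum>i<r. poly (A i) q * x ^ i)"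
      proof -
        have "poly (A i) q = (\<Sum>j\<le>d. coeff (A i) j * q ^ j)" if "i < r" for i
          using d[OF that] by (intro poly_eq_sum_le) simp
        then show ?thesis by (subst sum.swap) (simp add: sum_distrib_right)
      qed
      also have "\<dots> = poly b q * (\<Sum>i<r. coeff h i * x ^ i)"
        by (simp add: hA[symmetric] sum_distrib_left ac_simps)
      also have "(\<Sum>i<r. coeff h i * x ^ i) = (\<Sum>i\<le>r - 1. coeff h i * x ^ i)"
        using V(2) by (intro sum.cong) (auto simp: r_def)
      also have "\<dots> = poly h x"
        using h(2) degP by (intro poly_eq_sum_le[symmetric]) (simp add: r_def)
      finally show ?thesis using x(2) by simp
    qed
    ultimately have "S = 0"
      using transcendental[of x] x(1) algebraic_polys_over by (auto simp: P_def)
    then have "B j = 0" if "j \<le> d" for j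
      using homogeneous_form_eq_0[OF UV degB _ that] by (simp add: S_def)
    then have "coeff (A i) j = 0" if "i < r" for i j
      using that d[OF that] coeffB[OF that] by (metis coeff_0 coeff_eq_0 le_less_trans not_le)
    then have "A i = 0" if "i < r" for i using that by (intro poly_eqI) simp
    then have "coeff h i = 0" if "i < r" for i using that hA[of i] b by simp
    then show "h = 0"
      using h(2) degP by (metis leading_coeff_0_iff r_def)
  qed
  then show ?thesis
    using P_over leadP degP V(2) unfolding P_def[symmetric] K.irreducible_over_def by auto
qed

text \<open>
  A bad parameter equals \<open>U(x) / V(x)\<close> for an algebraic \<open>x\<close>, and there are only countably many of these.
\<close>
lemma exists_parameter_with_transcendental_roots:
  assumes "finite F" and UV: "\<And>U V. (U, V) \<in> F \<Longrightarrow> comaximal U V"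
  shows "\<exists>q :: real. q \<noteq> 0 \<and>
    (\<forall>(U, V) \<in> F. \<forall>x. poly (U - smult (of_real q) V) x = 0 \<longrightarrow> \<not> algebraic x)"
proof -
  define bad where "bad = insert 0 (\<Union>(U, V)\<in>F. (\<lambda>x. Re (poly U x / poly V x)) ` {x. algebraic x})"
  have "countable bad"
    unfolding bad_def using countable_finite[OF assms(1)] countable_algebraic
    by (auto intro!: countable_UN countable_image countable_insert)
  then obtain q where q: "q \<notin> bad"
    using uncountable_UNIV_real by (metis UNIV_eq_I)
  have "\<not> algebraic x" if "(U, V) \<in> F" "poly (U - smult (of_real q) V) x = 0" for U V x
  proof
    assume x: "algebraic x"
    have eq: "poly U x = of_real q * poly V x" using that(2) by simp
    then have "poly V x \<noteq> 0" using comaximal_no_common_root[OF UV[OF that(1)]] by fastforce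
    then have "q = Re (poly U x / poly V x)" by (simp add: eq)
    then show False using q x that(1) unfolding bad_def by blast
  qed
  then show ?thesis using q by (intro exI[of _ q]) (auto simp: bad_def)
qed

section \<open>Kronecker approximation in the presence of integer relations\<close>

text \<open>
  Independence of the family, not of the set of its values: a repeated value makes the family dependent.
\<close>
definition integer_independent :: "'i set \<Rightarrow> ('i \<Rightarrow> real) \<Rightarrow> bool" where
  "integer_independent B x \<longleftrightarrow>
     (\<forall>k :: 'i \<Rightarrow> int. (\<Sum>i\<in>B. of_int (k i) * x i) = 0 \<longrightarrow> (\<forall>i\<in>B. k i = 0))"

lemma integer_independentD:
  "integer_independent B x \<Longrightarrow> (\<Sum>i\<in>B. of_int (k i) * x i) = 0 \<Longrightarrow> i \<in> B \<Longrightarrow> k i = 0"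
  by (auto simp: integer_independent_def)

lemma Kronecker_integer_independent:
  fixes x a :: "'i \<Rightarrow> real"
  assumes B: "finite B" "integer_independent B x" and e: "e > 0"
  obtains t h where "\<And>i. i \<in> B \<Longrightarrow> \<bar>t * x i - of_int (h i) - a i\<bar> < e"
proof -
  define n where "n = card B"
  obtain f where f: "bij_betw f {..<n} B"
    using ex_bij_betw_nat_finite[OF B(1)] by (auto simp: n_def atLeast0LessThan)
  have inj: "inj_on x B"
  proof (rule inj_onI, rule ccontr)
    fix i j assume ij: "i \<in> B" "j \<in> B" "x i = x j" "i \<noteq> j"
    define k where "k l = (if l = i then 1 else if l = j then -1 else 0 :: int)" for l
    have "(\<Sum>l\<in>B. of_int (k l) * x l) = (\<Sum>l\<in>B. (if l = i then x i else 0) - (if l = j then x j else 0))"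
      using ij(4) by (intro sum.cong refl) (auto simp: k_def)
    also have "\<dots> = 0" using ij B(1) by (simp add: sum_subtractf)
    finally show False using integer_independentD[OF B(2) _ ij(1), of k] by (simp add: k_def)
  qed
  have inj': "inj_on (x \<circ> f) {..<n}"
    using f inj by (intro comp_inj_on) (auto simp: bij_betw_def)
  interpret Modules.module "\<lambda>r. (*) (real_of_int r)"
    by (simp add: Modules.module.intro distrib_left mult.commute)
  have image: "(x \<circ> f) ` {..<n} = x ` B"
    using f by (metis bij_betw_imp_surj_on image_comp)
  have "independent (x ` B)"
    unfolding dependent_finite[OF finite_imageI[OF B(1)]]
  proof (clarify)
    fix u i assume u: "(\<Sum>v\<in>x ` B. of_int (u v) * v) = 0" and i: "i \<in> B" "u (x i) \<noteq> 0"
    have "(\<Sum>l\<in>B. of_int (u (x l)) * x l) = 0"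
      using u by (simp add: sum.reindex[OF inj])
    from integer_independentD[OF B(2) this i(1)] show False using i(2) by simp
  qed
  then obtain t h where th: "\<And>m. m < n \<Longrightarrow> \<bar>t * (x \<circ> f) m - of_int (h m) - (a \<circ> f) m\<bar> < e"
    using Kronecker_thm_1[of "x \<circ> f" n e "a \<circ> f"] inj' e unfolding image by blast
  show thesis
  proof (rule that[of t "h \<circ> inv_into {..<n} f"])
    fix i assume "i \<in> B"
    then obtain m where "m < n" "i = f m" using f by (auto simp: bij_betw_def)
    then show "\<bar>t * x i - of_int ((h \<circ> inv_into {..<n} f) i) - a i\<bar> < e"
      using th[of m] f by (simp add: bij_betw_def inv_into_f_f)
  qed
qed

text \<open>
  Choose a maximal independent subfamily \<open>B\<close>. After multiplication by a common denominator \<open>D\<close>, every \<open>x j\<close> is an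
  integer combination of the \<open>x i\<close> with \<open>i\<close> in \<open>B\<close>, and by hypothesis the same combination gives \<open>a j\<close> from the
  \<open>a i\<close>. Approximation on \<open>B\<close>, for \<open>x / D\<close> and \<open>a / D\<close>, then carries over to all indices, since the
  combinations \<open>D x j = \<Sum> m j i x i\<close> turn integers into integers.
\<close>
theorem Kronecker_with_relations:
  fixes x a :: "'i \<Rightarrow> real"
  assumes I: "finite I"
    and rel: "\<And>k :: 'i \<Rightarrow> int. (\<Sum>i\<in>I. of_int (k i) * x i) = 0 \<Longrightarrow> (\<Sum>i\<in>I. of_int (k i) * a i) = 0"
    and e: "e > 0"
  obtains t h where "\<And>i. i \<in> I \<Longrightarrow> \<bar>t * x i - of_int (h i) - a i\<bar> < e"
proof -
  define good where "good B \<longleftrightarrow> B \<subseteq> I \<and> integer_independent B x" for B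
  have "good {}" by (auto simp: good_def integer_independent_def)
  moreover have "\<forall>B. good B \<longrightarrow> card B < Suc (card I)" using I by (auto simp: good_def card_mono less_Suc_eq_le)
  ultimately have "\<exists>B. good B \<and> (\<forall>C. good C \<longrightarrow> card C \<le> card B)"
    by (rule ex_has_greatest_nat)
  then obtain B where B: "good B" "\<And>C. good C \<Longrightarrow> card C \<le> card B" by blast
  have BI: "B \<subseteq> I" and indep: "integer_independent B x" using B(1) by (auto simp: good_def)
  have finB: "finite B" using BI I finite_subset by blast
  have dep: "\<exists>d k. d \<noteq> 0 \<and> of_int d * x j = (\<Sum>i\<in>B. of_int (k i) * x i)" if j: "j \<in> I" for j
  proof (cases "j \<in> B")
    case True
    have "of_int 1 * x j = (\<Sum>i\<in>B. of_int (if i = j then 1 else 0) * x i)"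
      using finB True by (simp add: if_distrib if_distribR cong: if_cong)
    then show ?thesis
      by (intro exI[of _ 1] exI[of _ "\<lambda>i. if i = j then 1 else 0"]) simp
  next
    case False
    then have "\<not> good (insert j B)" using B(2)[of "insert j B"] finB by auto
    then obtain k i where k: "(\<Sum>i\<in>insert j B. of_int (k i) * x i) = 0" "i \<in> insert j B" "k i \<noteq> 0"
    proof -
      have "\<not> integer_independent (insert j B) x"
        using \<open>\<not> good (insert j B)\<close> BI j by (simp add: good_def)
      then show ?thesis using that unfolding integer_independent_def by blast
    qed
    have eq: "of_int (k j) * x j + (\<Sum>i\<in>B. of_int (k i) * x i) = 0"
      using k(1) False finB by simp
    have "k j \<noteq> 0"
    proof
      assume "k j = 0"
      with eq have "(\<Sum>i\<in>B. of_int (k i) * x i) = 0" by simp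
      then have "\<forall>i\<in>B. k i = 0" using integer_independentD[OF indep] by blast
      then show False using k(2,3) \<open>k j = 0\<close> by blast
    qed
    moreover have "of_int (k j) * x j = (\<Sum>i\<in>B. of_int (- k i) * x i)"
      using eq by (simp add: sum_negf eq_neg_iff_add_eq_0)
    ultimately show ?thesis by (intro exI[of _ "k j"] exI[of _ "\<lambda>i. - k i"] conjI)
  qed
  then have "\<forall>j\<in>I. \<exists>dk. fst dk \<noteq> 0 \<and> of_int (fst dk) * x j = (\<Sum>i\<in>B. of_int (snd dk i) * x i)"
    by fastforce
  from bchoice[OF this] obtain dk where "\<forall>j\<in>I. fst (dk j) \<noteq> 0 \<and>
      of_int (fst (dk j)) * x j = (\<Sum>i\<in>B. of_int (snd (dk j) i) * x i)" ..
  then obtain d k where dk: "\<And>j. j \<in> I \<Longrightarrow> d j \<noteq> 0"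
    "\<And>j. j \<in> I \<Longrightarrow> of_int (d j) * x j = (\<Sum>i\<in>B. of_int (k j i) * x i)"
    using that[of "\<lambda>j. fst (dk j)" "\<lambda>j. snd (dk j)"] by blast
  define D where "D = (\<Prod>j\<in>I. d j)"
  have D: "D \<noteq> 0" using dk(1) I by (simp add: D_def)
  have "\<exists>m. of_int D * x j = (\<Sum>i\<in>B. of_int (m i) * x i)" if j: "j \<in> I" for j
  proof -
    have "D = d j * (\<Prod>l\<in>I - {j}. d l)" unfolding D_def using I j by (rule prod.remove)
    then have "of_int D * x j = of_int (\<Prod>l\<in>I - {j}. d l) * (of_int (d j) * x j)" by simp
    also have "\<dots> = (\<Sum>i\<in>B. of_int ((\<Prod>l\<in>I - {j}. d l) * k j i) * x i)"
      by (simp add: dk(2)[OF j] sum_distrib_left mult.assoc)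
    finally show ?thesis by (intro exI[of _ "\<lambda>i. (\<Prod>l\<in>I - {j}. d l) * k j i"])
  qed
  then have "\<forall>j\<in>I. \<exists>m. of_int D * x j = (\<Sum>i\<in>B. of_int (m i) * x i)" by blast
  from bchoice[OF this] obtain m where m: "\<And>j. j \<in> I \<Longrightarrow> of_int D * x j = (\<Sum>i\<in>B. of_int (m j i) * x i)"
    by blast
  have ma: "of_int D * a j = (\<Sum>i\<in>B. of_int (m j i) * a i)" if j: "j \<in> I" for j
  proof -
    define k where "k i = (if i = j then D else 0) - (if i \<in> B then m j i else 0)" for i
    have sum: "(\<Sum>i\<in>I. of_int (k i) * y i) = of_int D * y j - (\<Sum>i\<in>B. of_int (m j i) * y i)" for y :: "'i \<Rightarrow> real"
    proof -
      have "(\<Sum>i\<in>I. of_int (k i) * y i) =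
          (\<Sum>i\<in>I. (if i = j then of_int D * y j else 0) - (if i \<in> B then of_int (m j i) * y i else 0))"
        by (intro sum.cong refl) (auto simp: k_def algebra_simps)
      also have "\<dots> = of_int D * y j - (\<Sum>i\<in>I \<inter> B. of_int (m j i) * y i)"
        using I j by (simp add: sum_subtractf sum.inter_restrict)
      also have "I \<inter> B = B" using BI by blast
      finally show ?thesis .
    qed
    from rel[of k] show ?thesis using m[OF j] by (simp add: sum)
  qed
  \<comment> \<open>An integer combination magnifies the error by less than \<open>M\<close>.\<close>
  define M where "M = (\<Sum>j\<in>I. \<Sum>i\<in>B. \<bar>m j i\<bar>) + 1"
  have M: "(\<Sum>i\<in>B. \<bar>m j i\<bar>) < M" if "j \<in> I" for j
    using that I member_le_sum[of j I "\<lambda>j. \<Sum>i\<in>B. \<bar>m j i\<bar>"] by (force simp: M_def intro: sum_nonneg)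
  have Mpos: "M > 0" unfolding M_def by (intro add_nonneg_pos sum_nonneg) auto
  have indepD: "integer_independent B (\<lambda>i. x i / of_int D)"
    unfolding integer_independent_def
  proof (intro allI impI)
    fix k assume "(\<Sum>i\<in>B. of_int (k i) * (x i / of_int D)) = 0"
    then have "(\<Sum>i\<in>B. of_int (k i) * x i) / of_int D = 0" by (simp add: sum_divide_distrib)
    then have "(\<Sum>i\<in>B. of_int (k i) * x i) = 0" using D by simp
    then show "\<forall>i\<in>B. k i = 0" using integer_independentD[OF indep] by blast
  qed
  have "e / of_int M > 0" using e Mpos by simp
  then obtain t h where th: "\<And>i. i \<in> B \<Longrightarrow> \<bar>t * (x i / of_int D) - of_int (h i) - a i / of_int D\<bar> < e / of_int M"
    using Kronecker_integer_independent[OF finB indepD, of "e / of_int M" "\<lambda>i. a i / of_int D"] by blast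
  show thesis
  proof (rule that[of t "\<lambda>j. \<Sum>i\<in>B. m j i * h i"])
    fix j assume j: "j \<in> I"
    have xj: "x j = (\<Sum>i\<in>B. of_int (m j i) * (x i / of_int D))"
      using m[OF j] D by (simp add: sum_divide_distrib[symmetric] field_simps)
    have aj: "a j = (\<Sum>i\<in>B. of_int (m j i) * (a i / of_int D))"
      using ma[OF j] D by (simp add: sum_divide_distrib[symmetric] field_simps)
    have "t * x j - of_int (\<Sum>i\<in>B. m j i * h i) - a j =
        (\<Sum>i\<in>B. of_int (m j i) * (t * (x i / of_int D) - of_int (h i) - a i / of_int D))"
      unfolding xj aj by (simp add: sum_distrib_left sum_subtractf sum.distrib algebra_simps)
    also have "\<bar>\<dots>\<bar> \<le> (\<Sum>i\<in>B. of_int \<bar>m j i\<bar> * (e / of_int M))"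
      by (rule order.trans[OF sum_abs], rule sum_mono, simp only: abs_mult of_int_abs,
          intro mult_left_mono less_imp_le th abs_ge_zero)
    also have "\<dots> = of_int (\<Sum>i\<in>B. \<bar>m j i\<bar>) * (e / of_int M)"
      by (simp only: of_int_sum sum_distrib_right)
    also have "\<dots> < of_int M * (e / of_int M)"
      using M[OF j] e Mpos by (intro mult_strict_right_mono) (auto simp del: of_int_sum)
    finally show "\<bar>t * x j - of_int (\<Sum>i\<in>B. m j i * h i) - a j\<bar> < e" using Mpos by simp
  qed
qed

lemma simultaneous_phases:
  fixes x a :: "'i \<Rightarrow> real"
  assumes "finite I"
    and "\<And>k :: 'i \<Rightarrow> int. (\<Sum>i\<in>I. of_int (k i) * x i) = 0 \<Longrightarrow> (\<Sum>i\<in>I. of_int (k i) * a i) = 0"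
  obtains \<tau> :: "nat \<Rightarrow> real" where "\<And>i. i \<in> I \<Longrightarrow> (\<lambda>k. cis (\<tau> k * x i)) \<longlonglongrightarrow> cis (2 * pi * a i)"
proof -
  have "\<forall>k. \<exists>t h. \<forall>i\<in>I. \<bar>t * x i - of_int (h i) - a i\<bar> < inverse (real (Suc k))"
  proof
    fix k
    have "inverse (real (Suc k)) > 0" by simp
    from Kronecker_with_relations[OF assms this] obtain t h
      where "\<And>i. i \<in> I \<Longrightarrow> \<bar>t * x i - of_int (h i) - a i\<bar> < inverse (real (Suc k))" by blast
    then show "\<exists>t h. \<forall>i\<in>I. \<bar>t * x i - of_int (h i) - a i\<bar> < inverse (real (Suc k))" by blast
  qed
  from choice[OF this] obtain t where
    "\<forall>k. \<exists>h. \<forall>i\<in>I. \<bar>t k * x i - of_int (h i) - a i\<bar> < inverse (real (Suc k))" ..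
  from choice[OF this] obtain h where
    th: "\<And>k i. i \<in> I \<Longrightarrow> \<bar>t k * x i - of_int (h k i) - a i\<bar> < inverse (real (Suc k))" by blast
  have "(\<lambda>k. cis (2 * pi * t k * x i)) \<longlonglongrightarrow> cis (2 * pi * a i)" if i: "i \<in> I" for i
  proof -
    define \<delta> where "\<delta> k = t k * x i - of_int (h k i) - a i" for k
    have "\<delta> \<longlonglongrightarrow> 0"
      by (rule tendsto_rabs_zero_cancel, rule tendsto_sandwich[OF _ _ tendsto_const LIMSEQ_inverse_real_of_nat])
        (use th[OF i] in \<open>auto simp: \<delta>_def intro!: always_eventually less_imp_le\<close>)
    then have "(\<lambda>k. cis (2 * pi * \<delta> k) * cis (2 * pi * a i)) \<longlonglongrightarrow> cis (2 * pi * 0) * cis (2 * pi * a i)"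
      by (intro tendsto_intros tendsto_cis)
    moreover have "cis (2 * pi * t k * x i) = cis (2 * pi * \<delta> k) * cis (2 * pi * a i)" for k
    proof -
      have "2 * pi * t k * x i = 2 * pi * of_int (h k i) + (2 * pi * \<delta> k + 2 * pi * a i)"
        by (simp add: \<delta>_def algebra_simps)
      then show ?thesis by (simp only: cis_mult[symmetric]) simp
    qed
    ultimately show ?thesis by simp
  qed
  then show ?thesis by (intro that[of "\<lambda>k. 2 * pi * t k"])
qed

section \<open>Mirror-symmetric and antisymmetric vectors on the path\<close>

text \<open>
  Vectors are functions on \<open>nat\<close> here. This makes reflections and shifts of basis vectors identities between
  functions, free of dimension side conditions.
\<close>
locale function_operator =
  fixes T :: "(nat \<Rightarrow> complex) \<Rightarrow> nat \<Rightarrow> complex"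
  assumes T_add: "T (\<lambda>i. v i + w i) = (\<lambda>i. T v i + T w i)"
    and T_scale: "T (\<lambda>i. c * v i) = (\<lambda>i. c * T v i)"
begin

definition apply_poly :: "complex poly \<Rightarrow> (nat \<Rightarrow> complex) \<Rightarrow> nat \<Rightarrow> complex" where
  "apply_poly p v = fold_coeffs (\<lambda>a w i. a * v i + T w i) p (\<lambda>_. 0)"

lemma T_zero: "T (\<lambda>_. 0) = (\<lambda>_. 0)"
  using T_scale[of 0 "\<lambda>_. 0"] by simp

lemma apply_poly_0: "apply_poly 0 v = (\<lambda>_. 0)"
  by (simp add: apply_poly_def)

lemma apply_poly_pCons: "apply_poly (pCons a p) v = (\<lambda>i. a * v i + T (apply_poly p v) i)"
proof (cases "a = 0 \<and> p = 0")
  case True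
  then show ?thesis by (simp add: apply_poly_0 T_zero)
next
  case False
  then show ?thesis by (auto simp: apply_poly_def)
qed

lemma apply_poly_add: "apply_poly (p + q) v = (\<lambda>i. apply_poly p v i + apply_poly q v i)"
proof (induction p q rule: poly_induct2)
  case 0
  show ?case by (simp add: apply_poly_0)
next
  case (pCons a p b q)
  then show ?case by (simp add: apply_poly_pCons T_add algebra_simps)
qed

lemma apply_poly_smult: "apply_poly (smult c p) v = (\<lambda>i. c * apply_poly p v i)"
  by (induction p) (simp_all add: apply_poly_0 apply_poly_pCons T_scale algebra_simps)

lemma apply_poly_diff: "apply_poly (p - q) v = (\<lambda>i. apply_poly p v i - apply_poly q v i)"
  using apply_poly_add[of p "smult (- 1) q" v] apply_poly_smult[of "- 1" q v] by simp

lemma apply_poly_1: "apply_poly 1 v = v"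
  by (simp add: one_pCons apply_poly_pCons apply_poly_0 T_zero)

lemma apply_poly_X: "apply_poly ([:0, 1:] * p) v = T (apply_poly p v)"
  by (simp add: apply_poly_pCons)

lemma apply_poly_sum: "apply_poly (\<Sum>x\<in>X. p x) v = (\<lambda>i. \<Sum>x\<in>X. apply_poly (p x) v i)"
  by (induction X rule: infinite_finite_induct) (simp_all add: apply_poly_0 apply_poly_add)

end

text \<open>Both sides have degree less than \<open>card X\<close> and agree on \<open>X\<close>.\<close>
lemma lagrange_partition_of_unity:
  fixes X :: "complex set"
  assumes X: "finite X" "X \<noteq> {}"
  shows "(\<Sum>x\<in>X. smult (1 / (\<Prod>y\<in>X - {x}. x - y)) (\<Prod>y\<in>X - {x}. [:- y, 1:])) = 1" (is "?S = 1")
proof (rule ccontr)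
  assume "?S \<noteq> 1"
  then have nz: "?S - 1 \<noteq> 0" by simp
  have deg: "degree (smult (1 / (\<Prod>y\<in>X - {x}. x - y)) (\<Prod>y\<in>X - {x}. [:- y, 1:])) \<le> card X - 1"
    if "x \<in> X" for x
  proof -
    have "degree (\<Prod>y\<in>X - {x}. [:- y, 1:]) \<le> (\<Sum>y\<in>X - {x}. degree [:- y, 1:])"
      using degree_prod_sum_le[of "X - {x}" "\<lambda>y. [:- y, 1:]"] X by (simp add: o_def)
    also have "\<dots> = card X - 1" using that X by simp
    finally show ?thesis using degree_smult_le order.trans by blast
  qed
  have "degree ?S \<le> card X - 1" using deg X by (intro degree_sum_le) auto
  then have "degree (?S - 1) \<le> card X - 1" by (intro degree_diff_le) auto
  moreover have "card X > 0" using X by (simp add: card_gt_0_iff)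
  moreover have "poly (?S - 1) z = 0" if z: "z \<in> X" for z
  proof -
    have "(1 / (\<Prod>y\<in>X - {x}. x - y)) * (\<Prod>y\<in>X - {x}. z - y) = (if x = z then 1 else 0)" if "x \<in> X" for x
      using that z X(1) by (auto simp: prod_zero_iff)
    then have "poly ?S z = (\<Sum>x\<in>X. if x = z then 1 else 0)"
      by (simp add: poly_sum poly_prod)
    then show ?thesis using z X(1) by simp
  qed
  then have "card X \<le> card {z. poly (?S - 1) z = 0}"
    using poly_roots_finite[OF nz] by (intro card_mono) auto
  moreover have "card {z. poly (?S - 1) z = 0} \<le> degree (?S - 1)"
    using nz by (rule card_poly_roots_bound)
  ultimately show False by linarith
qed

text \<open>
  The Lagrange polynomials of \<open>X\<close>, applied to the operator, project \<open>v\<close> to the eigenspaces.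
\<close>
lemma (in function_operator) eigenvector_decomposition:
  assumes X: "finite X" "X \<noteq> {}" and kill: "apply_poly (\<Prod>x\<in>X. [:- x, 1:]) v = (\<lambda>_. 0)"
  obtains s where "\<And>x. x \<in> X \<Longrightarrow> T (s x) = (\<lambda>i. x * s x i)" "v = (\<lambda>i. \<Sum>x\<in>X. s x i)"
proof -
  define c where "c x = 1 / (\<Prod>y\<in>X - {x}. x - y)" for x
  define s where "s x = apply_poly (smult (c x) (\<Prod>y\<in>X - {x}. [:- y, 1:])) v" for x
  have "T (s x) = (\<lambda>i. x * s x i)" if x: "x \<in> X" for x
  proof -
    let ?r = "\<Prod>y\<in>X - {x}. [:- y, 1:]"
    have "(\<lambda>_. 0) = apply_poly (smult (c x) (\<Prod>x\<in>X. [:- x, 1:])) v"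
      by (simp add: apply_poly_smult kill)
    also have "smult (c x) (\<Prod>x\<in>X. [:- x, 1:]) = [:0, 1:] * smult (c x) ?r - smult x (smult (c x) ?r)"
      using prod.remove[OF X(1) x, of "\<lambda>x. [:- x, 1:]"] by (simp add: smult_diff_right mult.commute)
    finally show ?thesis
      unfolding apply_poly_diff apply_poly_X apply_poly_smult[of x] s_def[symmetric]
      by (simp add: fun_eq_iff)
  qed
  moreover have "v = (\<lambda>i. \<Sum>x\<in>X. s x i)"
    using apply_poly_1[of v] unfolding lagrange_partition_of_unity[OF X, symmetric] apply_poly_sum s_def c_def
    by simp
  ultimately show ?thesis by (rule that)
qed

text \<open>
  The matrix \<open>H\<close>: a vertex sums over its two neighbours, where an end vertex has itself, with weight \<open>q\<close>,
  in place of the missing neighbour.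
\<close>
definition path_operator :: "complex \<Rightarrow> nat \<Rightarrow> (nat \<Rightarrow> complex) \<Rightarrow> nat \<Rightarrow> complex" where
  "path_operator q n v i = (if i < n then
     (if i = 0 then q * v 0 else v (i - 1)) + (if Suc i = n then q * v i else v (Suc i)) else 0)"

lemma function_operator_path: "function_operator (path_operator q n)"
  by unfold_locales (auto simp: path_operator_def fun_eq_iff algebra_simps)

text \<open>
  The vector \<open>e\<^sub>k + \<epsilon> e\<^bsub>n-1-k\<^esub>\<close>: mirror-symmetric for \<open>\<epsilon> = 1\<close>, antisymmetric for \<open>\<epsilon> = - 1\<close>.
\<close>
definition mirror_vector :: "nat \<Rightarrow> complex \<Rightarrow> nat \<Rightarrow> nat \<Rightarrow> complex" where
  "mirror_vector n \<epsilon> k i = (if i = k then 1 else 0) + (if Suc (i + k) = n then \<epsilon> else 0)"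

lemma path_operator_mirror_vector_0:
  assumes "n \<ge> 2"
  shows "path_operator q n (mirror_vector n \<epsilon> 0) = (\<lambda>i. q * mirror_vector n \<epsilon> 0 i + mirror_vector n \<epsilon> 1 i)"
  using assms by (auto simp: fun_eq_iff path_operator_def mirror_vector_def)

lemma path_operator_mirror_vector_Suc:
  assumes "Suc (Suc k) < n"
  shows "path_operator q n (mirror_vector n \<epsilon> (Suc k)) =
    (\<lambda>i. mirror_vector n \<epsilon> k i + mirror_vector n \<epsilon> (Suc (Suc k)) i)"
  using assms by (auto simp: fun_eq_iff path_operator_def mirror_vector_def)

lemma mirror_vector_reflect:
  assumes "\<epsilon> = 1 \<or> \<epsilon> = - 1" "Suc (k + l) = n"
  shows "mirror_vector n \<epsilon> k = (\<lambda>i. \<epsilon> * mirror_vector n \<epsilon> l i)"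
  using assms by (auto simp: fun_eq_iff mirror_vector_def)

text \<open>
  Chebyshev polynomials of the second kind with shifted index: \<open>cheb (k + 1)\<close> is \<open>U\<^sub>k(x / 2)\<close>.
\<close>
fun cheb :: "nat \<Rightarrow> complex poly" where
  "cheb 0 = 0"
| "cheb (Suc 0) = 1"
| "cheb (Suc (Suc k)) = [:0, 1:] * cheb (Suc k) - cheb k"

text \<open>
  The vectors \<open>mirror_vector n \<epsilon> k\<close> obey the three-term recurrence of the Chebyshev polynomials, with
  first step \<open>H - q\<close> caused by the weight at the end vertex.
\<close>
lemma apply_path_poly_mirror_vector:
  assumes n: "n \<ge> 2"
  shows "k < n \<Longrightarrow> function_operator.apply_poly (path_operator q n) (cheb (Suc k) - smult q (cheb k))
    (mirror_vector n \<epsilon> 0) = mirror_vector n \<epsilon> k"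
proof (induction k rule: induct_nat_012)
  interpret function_operator "path_operator q n" by (rule function_operator_path)
  case 0
  show ?case by (simp add: apply_poly_1)
next
  interpret function_operator "path_operator q n" by (rule function_operator_path)
  case 1
  show ?case
    unfolding cheb.simps apply_poly_diff apply_poly_X apply_poly_smult apply_poly_1 apply_poly_0
    by (simp add: path_operator_mirror_vector_0[OF n])
next
  interpret function_operator "path_operator q n" by (rule function_operator_path)
  case (ge2 k)
  have "cheb (Suc (Suc (Suc k))) - smult q (cheb (Suc (Suc k))) =
      [:0, 1:] * (cheb (Suc (Suc k)) - smult q (cheb (Suc k))) - (cheb (Suc k) - smult q (cheb k))"
    by (simp add: algebra_simps smult_diff_right)
  then show ?case
    using ge2 path_operator_mirror_vector_Suc[of k n q \<epsilon>]
    by (simp only: apply_poly_diff[of "[:0, 1:] * (cheb (Suc (Suc k)) - smult q (cheb (Suc k)))"] apply_poly_X) auto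
qed

text \<open>
  With \<open>m = n div 2\<close>, the polynomial \<open>half_path_poly n \<epsilon> m - q * half_path_poly n \<epsilon> (m - 1)\<close> is the characteristic
  polynomial of \<open>H\<close> on the symmetric or antisymmetric vectors. The three cases are the ways in which
  an (anti)symmetric vector can continue across the centre of the path: the centre is an edge, or it is a vertex
  at which symmetric vectors are unconstrained and antisymmetric vectors vanish.
\<close>
definition half_path_poly :: "nat \<Rightarrow> complex \<Rightarrow> nat \<Rightarrow> complex poly" where
  "half_path_poly n \<epsilon> k =
     (if even n then cheb (Suc k) - smult \<epsilon> (cheb k)
      else if \<epsilon> = 1 then cheb (Suc (Suc k)) - cheb k else cheb (Suc k))"

definition half_path_degree :: "nat \<Rightarrow> complex \<Rightarrow> nat \<Rightarrow> nat" where
  "half_path_degree n \<epsilon> k = (if odd n \<and> \<epsilon> = 1 then Suc k else k)"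

text \<open>
  At the centre of the path, reflection identifies two consecutive members of the chain of mirror vectors (for even
  \<open>n\<close>), or two members at distance two (for odd \<open>n\<close> and \<open>\<epsilon> = 1\<close>), or a member with its own negative (for odd
  \<open>n\<close> and \<open>\<epsilon> = - 1\<close>). Expressed through the initial vector, this is a polynomial equation.
\<close>
lemma annihilates_mirror_vector:
  assumes n: "n \<ge> 2" "n div 2 = Suc l" and \<epsilon>: "\<epsilon> = 1 \<or> \<epsilon> = - 1"
  shows "function_operator.apply_poly (path_operator q n)
    (half_path_poly n \<epsilon> (Suc l) - smult q (half_path_poly n \<epsilon> l)) (mirror_vector n \<epsilon> 0) = (\<lambda>_. 0)"
proof -
  interpret function_operator "path_operator q n" by (rule function_operator_path)
  define w where "w k = cheb (Suc k) - smult q (cheb k)" for k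
  have w: "apply_poly (w k) (mirror_vector n \<epsilon> 0) = mirror_vector n \<epsilon> k" if "k < n" for k
    unfolding w_def using n(1) that by (rule apply_path_poly_mirror_vector)
  consider "even n" | "odd n" "\<epsilon> = 1" | "odd n" "\<epsilon> = - 1" using \<epsilon> by blast
  then show ?thesis
  proof cases
    case 1
    then have size: "n = Suc (Suc l + l)" using n(2) by presburger
    then have lt: "l < n" "Suc l < n" by simp_all
    then have "mirror_vector n \<epsilon> (Suc l) = (\<lambda>i. \<epsilon> * mirror_vector n \<epsilon> l i)"
      using \<epsilon> size by (intro mirror_vector_reflect) auto
    moreover have "half_path_poly n \<epsilon> (Suc l) - smult q (half_path_poly n \<epsilon> l) = w (Suc l) - smult \<epsilon> (w l)"
      using 1 by (simp add: half_path_poly_def w_def algebra_simps smult_diff_right)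
    ultimately show ?thesis
      using w[OF lt(1)] w[OF lt(2)] by (simp add: apply_poly_diff apply_poly_smult)
  next
    case 2
    then have size: "n = Suc (Suc (Suc l) + l)" using n(2) by presburger
    then have lt: "l < n" "Suc (Suc l) < n" by simp_all
    then have "mirror_vector n \<epsilon> (Suc (Suc l)) = (\<lambda>i. \<epsilon> * mirror_vector n \<epsilon> l i)"
      using \<epsilon> size by (intro mirror_vector_reflect) auto
    moreover have "half_path_poly n \<epsilon> (Suc l) - smult q (half_path_poly n \<epsilon> l) = w (Suc (Suc l)) - w l"
      using 2 by (simp add: half_path_poly_def w_def algebra_simps smult_diff_right)
    ultimately show ?thesis
      using w[OF lt(1)] w[OF lt(2)] 2 by (simp add: apply_poly_diff)
  next
    case 3
    then have size: "n = Suc (Suc l + Suc l)" using n(2) by presburger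
    then have lt: "Suc l < n" by simp_all
    then have "mirror_vector n \<epsilon> (Suc l) = (\<lambda>i. \<epsilon> * mirror_vector n \<epsilon> (Suc l) i)"
      using \<epsilon> size by (intro mirror_vector_reflect) auto
    then have "mirror_vector n \<epsilon> (Suc l) = (\<lambda>_. 0)"
      using 3 by (simp add: fun_eq_iff)
    moreover have "half_path_poly n \<epsilon> (Suc l) - smult q (half_path_poly n \<epsilon> l) = w (Suc l)"
      using 3 by (simp add: half_path_poly_def w_def)
    ultimately show ?thesis
      using w[OF lt] by simp
  qed
qed

lemma cheb_coeff_above: "k \<le> j \<Longrightarrow> coeff (cheb k) j = 0"
proof (induction k arbitrary: j rule: cheb.induct)
  case (2 j)
  then show ?case by (cases j) auto
next
  case (3 k j)
  then show ?case by (cases j) (auto simp: coeff_pCons)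
qed simp

lemma cheb_coeff_top: "coeff (cheb (Suc k)) k = 1"
  by (induction k rule: induct_nat_012) (simp_all add: cheb_coeff_above)

lemma cheb_coeff_below_top: "coeff (cheb (Suc (Suc k))) k = 0"
proof (induction k)
  case (Suc k)
  show ?case using Suc cheb_coeff_above[of "Suc k" "Suc k"] by simp
qed simp

lemma half_path_poly_coeffs:
  assumes \<epsilon>: "\<epsilon> = 1 \<or> \<epsilon> = - 1"
  shows half_path_poly_coeff_above: "half_path_degree n \<epsilon> k < j \<Longrightarrow> coeff (half_path_poly n \<epsilon> k) j = 0"
    and half_path_poly_coeff_top: "coeff (half_path_poly n \<epsilon> k) (half_path_degree n \<epsilon> k) = 1"
    and half_path_poly_coeff_below_top:
      "coeff (half_path_poly n \<epsilon> (Suc k)) (half_path_degree n \<epsilon> k) = (if even n then - \<epsilon> else 0)"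
proof -
  have "half_path_degree n \<epsilon> k < j \<Longrightarrow> coeff (half_path_poly n \<epsilon> k) j = 0"
    unfolding half_path_poly_def half_path_degree_def
    by (auto simp: cheb_coeff_above simp del: cheb.simps)
  moreover have "coeff (half_path_poly n \<epsilon> k) (half_path_degree n \<epsilon> k) = 1"
    unfolding half_path_poly_def half_path_degree_def
    by (simp add: cheb_coeff_above cheb_coeff_top del: cheb.simps split: if_splits)
  moreover have "coeff (half_path_poly n \<epsilon> (Suc k)) (half_path_degree n \<epsilon> k) = (if even n then - \<epsilon> else 0)"
    unfolding half_path_poly_def half_path_degree_def
    by (simp add: cheb_coeff_above cheb_coeff_top cheb_coeff_below_top del: cheb.simps split: if_splits)
  ultimately show "half_path_degree n \<epsilon> k < j \<Longrightarrow> coeff (half_path_poly n \<epsilon> k) j = 0"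
    "coeff (half_path_poly n \<epsilon> k) (half_path_degree n \<epsilon> k) = 1"
    "coeff (half_path_poly n \<epsilon> (Suc k)) (half_path_degree n \<epsilon> k) = (if even n then - \<epsilon> else 0)"
    by blast+
qed

lemma degree_half_path_poly:
  assumes "\<epsilon> = 1 \<or> \<epsilon> = - 1"
  shows "degree (half_path_poly n \<epsilon> k) = half_path_degree n \<epsilon> k"
proof (rule antisym)
  show "degree (half_path_poly n \<epsilon> k) \<le> half_path_degree n \<epsilon> k"
    by (rule degree_le) (simp add: half_path_poly_coeff_above[OF assms])
  show "half_path_degree n \<epsilon> k \<le> degree (half_path_poly n \<epsilon> k)"
    by (rule le_degree) (simp add: half_path_poly_coeff_top[OF assms])
qed

lemma half_path_poly_rec:
  "half_path_poly n \<epsilon> (Suc (Suc k)) = [:0, 1:] * half_path_poly n \<epsilon> (Suc k) - half_path_poly n \<epsilon> k"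
  by (simp add: half_path_poly_def algebra_simps smult_diff_right)

lemma cheb_polys_over: "cheb k \<in> polys_over \<int>"
proof (induction k rule: cheb.induct)
  case (3 k)
  then show ?case
    unfolding cheb.simps
    by (intro integers.diff_polys_over integers.mult_polys_over integers.pCons_polys_over
        integers.zero_polys_over integers.zero_closed integers.one_closed)
qed (auto intro: integers.zero_polys_over integers.one_polys_over)

lemma half_path_poly_polys_over:
  assumes "\<epsilon> = 1 \<or> \<epsilon> = - 1"
  shows "half_path_poly n \<epsilon> k \<in> polys_over \<int>"
proof -
  have "\<epsilon> \<in> \<int>" using assms by auto
  then show ?thesis unfolding half_path_poly_def
    by (auto simp del: cheb.simps intro!: cheb_polys_over integers.diff_polys_over integers.smult_polys_over)
qed

text \<open>
  The three-term recurrence carries a Bezout identity from one consecutive pair to the next.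
\<close>
lemma comaximal_half_path_poly:
  assumes \<epsilon>: "\<epsilon> = 1 \<or> \<epsilon> = - 1"
  shows "comaximal (half_path_poly n \<epsilon> (Suc k)) (half_path_poly n \<epsilon> k)"
proof (induction k)
  case 0
  show ?case
  proof (cases "odd n \<and> \<epsilon> = 1")
    case True
    then have "smult (- (1/2)) 1 * half_path_poly n \<epsilon> (Suc 0) + smult (1/2) [:0, 1:] * half_path_poly n \<epsilon> 0 = 1"
      by (simp add: half_path_poly_def one_pCons)
    then show ?thesis unfolding comaximal_def by blast
  next
    case False
    then have "0 * half_path_poly n \<epsilon> (Suc 0) + 1 * half_path_poly n \<epsilon> 0 = 1"
      by (auto simp: half_path_poly_def)
    then show ?thesis unfolding comaximal_def by blast
  qed
next
  case (Suc k)
  then obtain a b where ab: "a * half_path_poly n \<epsilon> (Suc k) + b * half_path_poly n \<epsilon> k = 1"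
    by (auto simp: comaximal_def)
  have "(- b) * half_path_poly n \<epsilon> (Suc (Suc k)) + (a + b * [:0, 1:]) * half_path_poly n \<epsilon> (Suc k) = 1"
    unfolding half_path_poly_rec ab[symmetric] by (simp only: algebra_simps) simp
  then show ?case unfolding comaximal_def by blast
qed

text \<open>By Vieta, the mean of the roots can be read off the second highest coefficient.\<close>
lemma root_mean_half_path_pencil:
  assumes \<epsilon>: "\<epsilon> = 1 \<or> \<epsilon> = - 1"
    and P: "P = half_path_poly n \<epsilon> (Suc l) - smult q (half_path_poly n \<epsilon> l)"
  shows "lead_coeff P = 1" "degree P = half_path_degree n \<epsilon> (Suc l)"
    "root_mean P = (q + (if even n then \<epsilon> else 0)) / of_nat (half_path_degree n \<epsilon> (Suc l))"
proof -
  let ?r = "half_path_degree n \<epsilon> (Suc l)"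
  have r: "?r = Suc (half_path_degree n \<epsilon> l)" by (simp add: half_path_degree_def)
  have top: "coeff P ?r = 1"
    using half_path_poly_coeff_top[OF \<epsilon>, of n "Suc l"] half_path_poly_coeff_above[OF \<epsilon>, of n l ?r]
    by (simp add: P r)
  have "coeff P j = 0" if "j > ?r" for j
    using that half_path_poly_coeff_above[OF \<epsilon>, of n l j] half_path_poly_coeff_above[OF \<epsilon>, of n "Suc l" j]
    by (simp add: P r)
  then have "degree P \<le> ?r" by (intro degree_le) simp
  moreover have "?r \<le> degree P" using top by (intro le_degree) simp
  ultimately show deg: "degree P = ?r" by simp
  show lead: "lead_coeff P = 1" using top deg by simp
  have "coeff P (degree P - 1) = (if even n then - \<epsilon> else 0) - q"
    using half_path_poly_coeff_below_top[OF \<epsilon>, of n l] half_path_poly_coeff_top[OF \<epsilon>, of n l]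
    by (simp add: P[symmetric] deg r) (simp add: P)
  then show "root_mean P = (q + (if even n then \<epsilon> else 0)) / of_nat ?r"
    unfolding root_mean_def using sum_proots_eq_coeff[OF lead] deg r by simp
qed

section \<open>Time evolution under the path Laplacian\<close>

lemma mat_exp_eigenvector:
  assumes M: "M \<in> carrier_mat n n" and w: "w \<in> carrier_vec n" and eigen: "M *\<^sub>v w = \<theta> \<cdot>\<^sub>v w"
  shows "mat_exp M *\<^sub>v w = exp \<theta> \<cdot>\<^sub>v w"
proof (rule eq_vecI)
  fix i assume "i < dim_vec (exp \<theta> \<cdot>\<^sub>v w)"
  then have i: "i < n" using w by simp
  have pow: "M ^\<^sub>m k *\<^sub>v w = \<theta> ^ k \<cdot>\<^sub>v w" for k
  proof (induction k)
    case (Suc k)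
    have "M ^\<^sub>m Suc k *\<^sub>v w = M ^\<^sub>m k *\<^sub>v (M *\<^sub>v w)"
      using M w by (simp add: assoc_mult_mat_vec[OF pow_carrier_mat[OF M] M w])
    also have "\<dots> = \<theta> \<cdot>\<^sub>v (M ^\<^sub>m k *\<^sub>v w)"
      unfolding eigen using pow_carrier_mat[OF M, of k] w by (rule mult_mat_vec)
    also have "\<dots> = \<theta> ^ Suc k \<cdot>\<^sub>v w"
      using Suc by (simp add: smult_smult_assoc)
    finally show ?case .
  qed (use M w in simp)
  have entry: "(\<Sum>j<n. (M ^\<^sub>m k) $$ (i, j) * w $ j) = \<theta> ^ k * w $ i" for k
  proof -
    have "(M ^\<^sub>m k *\<^sub>v w) $ i = (\<Sum>j<n. (M ^\<^sub>m k) $$ (i, j) * w $ j)"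
    proof -
      have "dim_row (M ^\<^sub>m k) = n" "dim_col (M ^\<^sub>m k) = n" using pow_carrier_mat[OF M, of k] by auto
      then show ?thesis using w i by (simp add: scalar_prod_def atLeast0LessThan)
    qed
    then show ?thesis using w i by (simp add: pow)
  qed
  have "(mat_exp M *\<^sub>v w) $ i = (\<Sum>j<n. (\<Sum>k. (M ^\<^sub>m k) $$ (i, j) / fact k) * w $ j)"
    using M w i by (simp add: mat_exp_def scalar_prod_def atLeast0LessThan)
  also have "\<dots> = (\<Sum>j<n. \<Sum>k. (M ^\<^sub>m k) $$ (i, j) / fact k * w $ j)"
    using summable_mat_exp[OF M i] by (intro sum.cong refl suminf_mult2) auto
  also have "\<dots> = (\<Sum>k. \<Sum>j<n. (M ^\<^sub>m k) $$ (i, j) / fact k * w $ j)"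
    using summable_mat_exp[OF M i] by (intro suminf_sum[symmetric] summable_mult2) auto
  also have "\<dots> = (\<Sum>k. \<theta> ^ k * w $ i / fact k)"
    by (simp add: entry[symmetric] sum_divide_distrib)
  also have "\<dots> = (\<Sum>k. \<theta> ^ k /\<^sub>R fact k * w $ i)"
    by (simp add: scaleR_conv_of_real field_simps)
  also have "\<dots> = exp \<theta> * w $ i"
    unfolding exp_def by (intro suminf_mult2[symmetric] summable_exp_generic)
  finally show "(mat_exp M *\<^sub>v w) $ i = (exp \<theta> \<cdot>\<^sub>v w) $ i" using w i by simp
qed (use M w in \<open>simp add: mat_exp_def\<close>)

lemma path_laplacian_carrier:
  "map_mat complex_of_real (q_laplacian q n (path_graph n)) \<in> carrier_mat n n"
  by (rule carrier_matI) (simp_all add: q_laplacian_def adjacency_matrix_def)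

lemma path_laplacian_mult_vec:
  assumes n: "n \<ge> 2" and i: "i < n"
  shows "(\<Sum>j<n. map_mat complex_of_real (q_laplacian q n (path_graph n)) $$ (i, j) * w j) =
    (1 + (of_real q)\<^sup>2) * w i - of_real q * path_operator (of_real q) n w i"
proof -
  define N where "N = {k. k < n \<and> path_graph n i k}"
  have N: "N = (if i = 0 then {} else {i - 1}) \<union> (if Suc i = n then {} else {Suc i})"
    using i by (auto simp: N_def path_graph_def)
  have "(\<Sum>j<n. map_mat complex_of_real (q_laplacian q n (path_graph n)) $$ (i, j) * w j) =
    (\<Sum>j<n. (if j = i then (1 - (of_real q)\<^sup>2 + (of_real q)\<^sup>2 * of_nat (card N)) * w i else 0) -
      of_real q * (if j \<in> N then w j else 0))"
    using i by (intro sum.cong refl)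
      (auto simp: q_laplacian_def adjacency_matrix_def degree_matrix_def vertex_degree_def N_def algebra_simps)
  also have "\<dots> = (1 - (of_real q)\<^sup>2 + (of_real q)\<^sup>2 * of_nat (card N)) * w i - of_real q * (\<Sum>j\<in>{..<n} \<inter> N. w j)"
    using i by (simp add: sum_subtractf sum_distrib_left[symmetric] sum.inter_restrict)
  also have "{..<n} \<inter> N = N" by (auto simp: N_def)
  also have "(1 - (of_real q)\<^sup>2 + (of_real q)\<^sup>2 * of_nat (card N)) * w i - of_real q * (\<Sum>j\<in>N. w j) =
    (1 + (of_real q)\<^sup>2) * w i - of_real q * path_operator (of_real q) n w i"
    using n i by (auto simp: N path_operator_def algebra_simps power2_eq_square)
  finally show ?thesis .
qed

lemma path_laplacian_symmetric:
  assumes "i < n" "j < n"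
  shows "q_laplacian q n (path_graph n) $$ (i, j) = q_laplacian q n (path_graph n) $$ (j, i)"
  using assms by (auto simp: q_laplacian_def adjacency_matrix_def degree_matrix_def path_graph_def)

lemma real_symmetric_eigenvalue_real:
  fixes a :: "nat \<Rightarrow> nat \<Rightarrow> real" and w :: "nat \<Rightarrow> complex"
  assumes sym: "\<And>i j. i < n \<Longrightarrow> j < n \<Longrightarrow> a i j = a j i"
    and eigen: "\<And>i. i < n \<Longrightarrow> (\<Sum>j<n. of_real (a i j) * w j) = \<theta> * w i"
    and nz: "l < n" "w l \<noteq> 0"
  shows "\<theta> \<in> \<real>"
proof -
  define S where "S = (\<Sum>i<n. \<Sum>j<n. cnj (w i) * of_real (a i j) * w j)"
  define N where "N = (\<Sum>i<n. (cmod (w i))\<^sup>2)"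
  have "N \<ge> (cmod (w l))\<^sup>2" unfolding N_def using nz(1) by (intro member_le_sum) auto
  then have N: "N > 0" using nz(2) by (smt (verit) zero_less_norm_iff zero_less_power)
  have "S = (\<Sum>i<n. cnj (w i) * (\<theta> * w i))"
    unfolding S_def by (intro sum.cong refl) (simp add: eigen[symmetric] sum_distrib_left mult.assoc)
  also have "\<dots> = \<theta> * of_real N"
    by (simp add: N_def sum_distrib_left complex_norm_square ac_simps del: of_real_power)
  finally have S: "S = \<theta> * of_real N" .
  have "cnj S = (\<Sum>i<n. \<Sum>j<n. cnj (w j) * of_real (a j i) * w i)"
    unfolding S_def by (simp add: sym ac_simps)
  also have "\<dots> = S" unfolding S_def by (rule sum.swap)
  finally have "S \<in> \<real>" by (simp add: Reals_cnj_iff)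
  then have "S / of_real N \<in> \<real>" by (intro Reals_divide) auto
  then show ?thesis using S N by simp
qed

section \<open>State transfer between the end vertices\<close>

theorem theorem10:
  fixes n :: nat
  assumes "n \<ge> 2"
  shows "\<exists>q :: real. q \<noteq> 0 \<and>
           pretty_good_state_transfer (q_laplacian q n (path_graph n)) 0 (n - 1)"
proof -
  obtain l where l: "n div 2 = Suc l" using assms by (cases "n div 2") auto
  define E where "E = {1, - 1 :: complex}"
  have E: "\<epsilon> = 1 \<or> \<epsilon> = - 1" if "\<epsilon> \<in> E" for \<epsilon> using that by (auto simp: E_def)
  obtain q :: real where q: "q \<noteq> 0" and transcendental:
    "\<And>\<epsilon> x. \<epsilon> \<in> E \<Longrightarrow> poly (half_path_poly n \<epsilon> (Suc l) - smult (of_real q) (half_path_poly n \<epsilon> l)) x = 0 \<Longrightarrow>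
      \<not> algebraic x"
  proof -
    have "\<exists>q :: real. q \<noteq> 0 \<and> (\<forall>(U, V) \<in> (\<lambda>\<epsilon>. (half_path_poly n \<epsilon> (Suc l), half_path_poly n \<epsilon> l)) ` E.
        \<forall>x. poly (U - smult (of_real q) V) x = 0 \<longrightarrow> \<not> algebraic x)"
      by (rule exists_parameter_with_transcendental_roots)
        (auto simp: E_def intro: comaximal_half_path_poly)
    then show ?thesis using that by auto
  qed
  define c where "c = complex_of_real q"
  interpret K: complex_subfield "field_generated_by c" by (rule complex_subfield_generated_by)
  interpret T: function_operator "path_operator c n" by (rule function_operator_path)
  define P where "P \<epsilon> = half_path_poly n \<epsilon> (Suc l) - smult c (half_path_poly n \<epsilon> l)" for \<epsilon>
  note P_props = root_mean_half_path_pencil[OF E P_def]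
  have irred: "K.irreducible_over (P \<epsilon>)" if \<epsilon>: "\<epsilon> \<in> E" for \<epsilon>
    unfolding P_def
  proof (rule irreducible_over_pencil)
    show "lead_coeff (half_path_poly n \<epsilon> (Suc l)) = 1"
      using half_path_poly_coeff_top[OF E[OF \<epsilon>]] by (simp add: degree_half_path_poly[OF E[OF \<epsilon>]])
    show "degree (half_path_poly n \<epsilon> l) < degree (half_path_poly n \<epsilon> (Suc l))"
      by (simp add: degree_half_path_poly[OF E[OF \<epsilon>]] half_path_degree_def)
    show "\<not> algebraic x" if "poly (half_path_poly n \<epsilon> (Suc l) - smult c (half_path_poly n \<epsilon> l)) x = 0" for x
      using that transcendental[OF \<epsilon>] by (simp add: c_def)
  qed (intro half_path_poly_polys_over comaximal_half_path_poly E \<epsilon>)+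
  define X where "X \<epsilon> = {x. poly (P \<epsilon>) x = 0}" for \<epsilon>
  have X: "finite (X \<epsilon>)" "X \<epsilon> \<noteq> {}" "(\<Prod>x\<in>X \<epsilon>. [:- x, 1:]) = P \<epsilon>" if \<epsilon>: "\<epsilon> \<in> E" for \<epsilon>
  proof -
    have "P \<epsilon> \<noteq> 0" using P_props(1)[OF \<epsilon>] by auto
    then show "finite (X \<epsilon>)" unfolding X_def by (rule poly_roots_finite)
    have "degree (P \<epsilon>) \<noteq> 0" using P_props(2)[OF \<epsilon>] by (simp add: half_path_degree_def)
    then have "\<exists>z. poly (P \<epsilon>) z = 0"
      using fundamental_theorem_of_algebra[of "P \<epsilon>"] constant_degree[of "P \<epsilon>"] by simp
    then show "X \<epsilon> \<noteq> {}" by (simp add: X_def)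
    show "(\<Prod>x\<in>X \<epsilon>. [:- x, 1:]) = P \<epsilon>"
      using complex_poly_decompose_rsquarefree[OF K.irreducible_over_rsquarefree[OF irred[OF \<epsilon>]]]
        P_props(1)[OF \<epsilon>] by (simp add: X_def)
  qed
  have "\<exists>s. (\<forall>x\<in>X \<epsilon>. path_operator c n (s x) = (\<lambda>i. x * s x i)) \<and>
      mirror_vector n \<epsilon> 0 = (\<lambda>i. \<Sum>x\<in>X \<epsilon>. s x i)" if \<epsilon>: "\<epsilon> \<in> E" for \<epsilon>
    using T.eigenvector_decomposition[OF X(1,2)[OF \<epsilon>], of "mirror_vector n \<epsilon> 0"]
      annihilates_mirror_vector[OF assms l E[OF \<epsilon>], of c] X(3)[OF \<epsilon>]
    unfolding P_def[symmetric] by metis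
  then have "\<forall>\<epsilon>\<in>E. \<exists>s. (\<forall>x\<in>X \<epsilon>. path_operator c n (s x) = (\<lambda>i. x * s x i)) \<and>
      mirror_vector n \<epsilon> 0 = (\<lambda>i. \<Sum>x\<in>X \<epsilon>. s x i)" by blast
  from bchoice[OF this] obtain s where
    s_eigen: "\<And>\<epsilon> x. \<epsilon> \<in> E \<Longrightarrow> x \<in> X \<epsilon> \<Longrightarrow> path_operator c n (s \<epsilon> x) = (\<lambda>i. x * s \<epsilon> x i)"
    and s_sum: "\<And>\<epsilon>. \<epsilon> \<in> E \<Longrightarrow> mirror_vector n \<epsilon> 0 = (\<lambda>i. \<Sum>x\<in>X \<epsilon>. s \<epsilon> x i)" by blast
  define L where "L = map_mat complex_of_real (q_laplacian q n (path_graph n))"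
  have L: "L \<in> carrier_mat n n" unfolding L_def by (rule path_laplacian_carrier)
  define \<theta> where "\<theta> x = 1 + c\<^sup>2 - c * x" for x
  have eigen: "(\<Sum>j<n. L $$ (i, j) * s \<epsilon> x j) = \<theta> x * s \<epsilon> x i" if "\<epsilon> \<in> E" "x \<in> X \<epsilon>" "i < n" for \<epsilon> x i
    using path_laplacian_mult_vec[OF assms that(3), of q "s \<epsilon> x"] s_eigen[OF that(1,2)]
    by (simp add: L_def[symmetric] c_def[symmetric] \<theta>_def algebra_simps)
  define I where "I = Sigma E X"
  have finI: "finite I" unfolding I_def using X(1) by (auto simp: E_def)
  \<comment> \<open>Only nonzero eigenvectors witness that an eigenvalue is real, and only they contribute to
    the evolution.\<close>
  define J where "J = {p \<in> I. \<exists>i<n. s (fst p) (snd p) i \<noteq> 0}"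
  have finJ: "finite J" using finI by (simp add: J_def)
  have \<theta>_real: "of_real (Re (\<theta> (snd p))) = \<theta> (snd p)" if "p \<in> J" for p
  proof -
    from that obtain i where p: "fst p \<in> E" "snd p \<in> X (fst p)" and i: "i < n" "s (fst p) (snd p) i \<noteq> 0"
      by (auto simp: J_def I_def)
    have "\<theta> (snd p) \<in> \<real>"
    proof (rule real_symmetric_eigenvalue_real[where w = "s (fst p) (snd p)" and l = i and n = n
          and a = "\<lambda>i j. q_laplacian q n (path_graph n) $$ (i, j)"])
      show "q_laplacian q n (path_graph n) $$ (i, j) = q_laplacian q n (path_graph n) $$ (j, i)"
        if "i < n" "j < n" for i j using that by (rule path_laplacian_symmetric)
      show "(\<Sum>j<n. of_real (q_laplacian q n (path_graph n) $$ (i, j)) * s (fst p) (snd p) j) =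
          \<theta> (snd p) * s (fst p) (snd p) i" if "i < n" for i
        using eigen[OF p that] that path_laplacian_carrier[of q n] by (simp add: L_def)
    qed (fact i)+
    then show ?thesis by (simp add: of_real_Re)
  qed
  define \<mu> where "\<mu> \<epsilon> = (q + (if even n then Re \<epsilon> else 0)) / real (half_path_degree n \<epsilon> (Suc l))" for \<epsilon>
  have \<mu>: "root_mean (P \<epsilon>) = of_real (\<mu> \<epsilon>)" if "\<epsilon> \<in> E" for \<epsilon>
    using P_props(3)[OF that] E[OF that] by (auto simp: \<mu>_def c_def)
  have \<mu>_neq: "\<mu> 1 \<noteq> \<mu> (- 1)"
  proof (cases "even n")
    case True
    then show ?thesis by (simp add: \<mu>_def half_path_degree_def divide_simps)
  next
    case False
    then have "\<mu> 1 = q / real (Suc (Suc l))" "\<mu> (- 1) = q / real (Suc l)"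
      by (simp_all add: \<mu>_def half_path_degree_def)
    then show ?thesis using q by (simp add: frac_eq_eq)
  qed
  \<comment> \<open>The scale that makes the two wanted phases differ by half a turn.\<close>
  define k0 where "k0 = 1 / (2 * q * (\<mu> (- 1) - \<mu> 1))"
  \<comment> \<open>The wanted phase, in turns: a multiple of the eigenvalue of \<open>L\<close> in which the root is replaced by
    the mean of its conjugates.\<close>
  define a where "a p = k0 * (1 + q\<^sup>2 - q * \<mu> (fst p))" for p :: "complex \<times> complex"
  have relation: "(\<Sum>p\<in>J. of_int (k p) * a p) = 0"
    if k: "(\<Sum>p\<in>J. of_int (k p) * Re (\<theta> (snd p))) = 0" for k :: "complex \<times> complex \<Rightarrow> int"
  proof -
    define d where "d = (1 + c\<^sup>2) / c * of_int (\<Sum>p\<in>J. k p)"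
    have c: "c \<noteq> 0" using q by (simp add: c_def)
    have cK: "c \<in> field_generated_by c" by (rule generator_in_field_generated_by)
    have "(\<Sum>p\<in>J. of_int (k p) * \<theta> (snd p)) = of_real (\<Sum>p\<in>J. of_int (k p) * Re (\<theta> (snd p)))"
      using \<theta>_real by simp
    then have "(\<Sum>p\<in>J. of_int (k p) * \<theta> (snd p)) = 0" using k by simp
    then have rel: "(\<Sum>p\<in>J. of_int (k p) * snd p) = d"
      using c by (simp add: \<theta>_def d_def sum.distrib sum_subtractf sum_distrib_left sum_distrib_right field_simps)
    have "(\<Sum>p\<in>J. of_int (k p) * root_mean (P (fst p))) = d"
    proof (rule K.linear_relation_root_means[OF finJ])
      show "K.irreducible_over (P (fst p))" if "p \<in> J" for p
        using that irred by (auto simp: J_def I_def)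
      show "poly (P (fst p)) (snd p) = 0" if "p \<in> J" for p
        using that by (auto simp: J_def I_def X_def)
      show "d \<in> field_generated_by c"
        unfolding d_def power2_eq_square
        by (intro K.mult_closed K.divide_closed K.add_closed K.one_closed K.of_int_closed cK)
    qed (rule K.of_int_closed rel)+
    moreover have "root_mean (P (fst p)) = of_real (\<mu> (fst p))" if "p \<in> J" for p
      using that \<mu> by (auto simp: J_def I_def)
    ultimately have "of_real (\<Sum>p\<in>J. of_int (k p) * \<mu> (fst p)) = d" by simp
    also have "d = of_real ((1 + q\<^sup>2) / q * of_int (\<Sum>p\<in>J. k p))"
      by (simp add: d_def c_def)
    finally have mean: "(\<Sum>p\<in>J. of_int (k p) * \<mu> (fst p)) = (1 + q\<^sup>2) / q * of_int (\<Sum>p\<in>J. k p)"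
      by (simp only: of_real_eq_iff)
    have "(\<Sum>p\<in>J. of_int (k p) * a p) =
        k0 * ((1 + q\<^sup>2) * of_int (\<Sum>p\<in>J. k p) - q * (\<Sum>p\<in>J. of_int (k p) * \<mu> (fst p)))"
      by (simp add: a_def sum_distrib_left sum_subtractf sum.distrib algebra_simps)
    also have "\<dots> = 0" using q by (simp add: mean)
    finally show ?thesis .
  qed
  obtain \<tau> where \<tau>: "\<And>p. p \<in> J \<Longrightarrow> (\<lambda>k. cis (\<tau> k * Re (\<theta> (snd p)))) \<longlonglongrightarrow> cis (2 * pi * a p)"
    using simultaneous_phases[OF finJ, where x = "\<lambda>p. Re (\<theta> (snd p))" and a = a, OF relation] by blast
  define \<gamma> where "\<gamma> = cis (2 * pi * (k0 * (1 + q\<^sup>2 - q * \<mu> 1)))"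
  have phase: "cis (2 * pi * a p) = fst p * \<gamma>" if "p \<in> J" for p
  proof -
    have "fst p \<in> E" using that by (auto simp: J_def I_def)
    from E[OF this] show ?thesis
    proof
      assume "fst p = 1"
      then show ?thesis by (simp add: a_def \<gamma>_def)
    next
      assume p: "fst p = - 1"
      have "2 * k0 * q * (\<mu> 1 - \<mu> (- 1)) = - 1"
        using \<mu>_neq q by (simp add: k0_def field_simps)
      then have a: "a p = k0 * (1 + q\<^sup>2 - q * \<mu> 1) - 1 / 2"
        by (simp add: a_def p algebra_simps)
      have "2 * pi * a p = 2 * pi * (k0 * (1 + q\<^sup>2 - q * \<mu> 1)) - pi"
        unfolding a by (simp add: right_diff_distrib)
      then show ?thesis by (simp add: p \<gamma>_def cis_divide[symmetric])
    qed
  qed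
  have weighted_sum: "(\<Sum>p\<in>J. f (fst p) * s (fst p) (snd p) i) =
      f 1 * mirror_vector n 1 0 i + f (- 1) * mirror_vector n (- 1) 0 i" if i: "i < n" for f i
  proof -
    have "(\<Sum>p\<in>J. f (fst p) * s (fst p) (snd p) i) = (\<Sum>p\<in>I. f (fst p) * s (fst p) (snd p) i)"
      using i finI by (intro sum.mono_neutral_left) (auto simp: J_def)
    also have "\<dots> = (\<Sum>\<epsilon>\<in>E. \<Sum>x\<in>X \<epsilon>. f \<epsilon> * s \<epsilon> x i)"
      unfolding I_def using X(1) by (subst sum.Sigma) (auto simp: E_def split_beta)
    also have "\<dots> = (\<Sum>\<epsilon>\<in>E. f \<epsilon> * mirror_vector n \<epsilon> 0 i)"
      by (intro sum.cong refl) (simp add: s_sum sum_distrib_left)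
    finally show ?thesis by (simp add: E_def)
  qed
  have source: "(\<Sum>p\<in>J. s (fst p) (snd p) i / 2) = unit_vec n 0 $ i" if i: "i < n" for i
    using weighted_sum[OF i, of "\<lambda>_. 1 / 2"] i assms by (auto simp: mirror_vector_def)
  have target: "(\<Sum>p\<in>J. fst p * s (fst p) (snd p) i / 2) = unit_vec n (n - 1) $ i" if i: "i < n" for i
    using weighted_sum[OF i, of "\<lambda>\<epsilon>. \<epsilon> / 2"] i assms by (auto simp: mirror_vector_def)
  have evolution: "(mat_exp ((\<i> * of_real t) \<cdot>\<^sub>m L) *\<^sub>v unit_vec n 0) $ i =
      (\<Sum>p\<in>J. cis (t * Re (\<theta> (snd p))) * (s (fst p) (snd p) i / 2))" if i: "i < n" for t i
  proof -
    define M where "M = (\<i> * of_real t) \<cdot>\<^sub>m L"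
    have M: "M \<in> carrier_mat n n" using L by (simp add: M_def)
    have dim: "dim_row (mat_exp M) = n" "dim_col (mat_exp M) = n"
      using M by (simp_all add: mat_exp_def)
    have step: "(\<Sum>j<n. mat_exp M $$ (i, j) * s (fst p) (snd p) j) =
        cis (t * Re (\<theta> (snd p))) * s (fst p) (snd p) i" if p: "p \<in> J" for p
    proof -
      define w where "w = Matrix.vec n (s (fst p) (snd p))"
      have w: "w \<in> carrier_vec n" by (simp add: w_def)
      have p': "fst p \<in> E" "snd p \<in> X (fst p)" using p by (auto simp: J_def I_def)
      have "M *\<^sub>v w = (\<i> * of_real t * \<theta> (snd p)) \<cdot>\<^sub>v w"
      proof (rule eq_vecI)
        fix j assume "j < dim_vec ((\<i> * of_real t * \<theta> (snd p)) \<cdot>\<^sub>v w)"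
        then have j: "j < n" using w by simp
        have "(M *\<^sub>v w) $ j = (\<Sum>l<n. \<i> * of_real t * (L $$ (j, l) * s (fst p) (snd p) l))"
          using j L by (simp add: M_def w_def scalar_prod_def atLeast0LessThan mult.assoc)
        also have "\<dots> = \<i> * of_real t * (\<theta> (snd p) * s (fst p) (snd p) j)"
          by (simp only: sum_distrib_left[symmetric] eigen[OF p' j])
        finally show "(M *\<^sub>v w) $ j = ((\<i> * of_real t * \<theta> (snd p)) \<cdot>\<^sub>v w) $ j"
          using j by (simp add: w_def)
      qed (use M in \<open>simp add: w_def\<close>)
      from mat_exp_eigenvector[OF M w this]
      have "(mat_exp M *\<^sub>v w) $ i = (exp (\<i> * of_real t * \<theta> (snd p)) \<cdot>\<^sub>v w) $ i" by simp
      moreover have "exp (\<i> * of_real t * \<theta> (snd p)) = cis (t * Re (\<theta> (snd p)))"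
        using \<theta>_real[OF p] by (simp add: cis_conv_exp mult.assoc)
      ultimately show ?thesis
        using i dim by (simp add: w_def scalar_prod_def atLeast0LessThan)
    qed
    have "(mat_exp M *\<^sub>v unit_vec n 0) $ i =
        (\<Sum>j<n. mat_exp M $$ (i, j) * (\<Sum>p\<in>J. s (fst p) (snd p) j / 2))"
      using i dim by (simp add: scalar_prod_def atLeast0LessThan source)
    also have "\<dots> = (\<Sum>p\<in>J. (\<Sum>j<n. mat_exp M $$ (i, j) * s (fst p) (snd p) j) / 2)"
      by (simp add: sum_distrib_left sum_divide_distrib) (rule sum.swap)
    also have "\<dots> = (\<Sum>p\<in>J. cis (t * Re (\<theta> (snd p))) * (s (fst p) (snd p) i / 2))"
      by (intro sum.cong refl) (simp add: step)
    finally show ?thesis by (simp only: M_def)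
  qed
  have dims: "dim_row (q_laplacian q n (path_graph n)) = n"
    by (simp add: q_laplacian_def adjacency_matrix_def)
  have "pretty_good_state_transfer (q_laplacian q n (path_graph n)) 0 (n - 1)"
    unfolding pretty_good_state_transfer_def dims vec_tendsto_def L_def[symmetric]
  proof (intro conjI exI allI impI)
    show "0 < n" "n - 1 < n" "0 \<noteq> n - 1" using assms by auto
    show "cmod \<gamma> = 1" by (simp add: \<gamma>_def)
    show "dim_vec (mat_exp ((\<i> * complex_of_real (\<tau> k)) \<cdot>\<^sub>m L) *\<^sub>v unit_vec n 0) =
        dim_vec (\<gamma> \<cdot>\<^sub>v unit_vec n (n - 1))" for k
      using L by (simp add: mat_exp_def)
    fix i assume "i < dim_vec (\<gamma> \<cdot>\<^sub>v unit_vec n (n - 1))"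
    then have i: "i < n" by simp
    have "(\<lambda>k. \<Sum>p\<in>J. cis (\<tau> k * Re (\<theta> (snd p))) * (s (fst p) (snd p) i / 2))
        \<longlonglongrightarrow> (\<Sum>p\<in>J. cis (2 * pi * a p) * (s (fst p) (snd p) i / 2))"
      by (intro tendsto_sum tendsto_mult_right \<tau>)
    also have "(\<Sum>p\<in>J. cis (2 * pi * a p) * (s (fst p) (snd p) i / 2)) =
        \<gamma> * (\<Sum>p\<in>J. fst p * s (fst p) (snd p) i / 2)"
      unfolding sum_distrib_left by (intro sum.cong refl) (simp add: phase)
    also have "\<dots> = (\<gamma> \<cdot>\<^sub>v unit_vec n (n - 1)) $ i" using i by (simp add: target)
    finally show "(\<lambda>k. (mat_exp ((\<i> * complex_of_real (\<tau> k)) \<cdot>\<^sub>m L) *\<^sub>v unit_vec n 0) $ i)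
        \<longlonglongrightarrow> (\<gamma> \<cdot>\<^sub>v unit_vec n (n - 1)) $ i"
      by (simp only: evolution[OF i])
  qed
  then show ?thesis using q by blast
qed

end
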